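(* Let $A$ be a finite dimensional Hopf $*$-algebra acting on a unital $C^*$-algebra $M$, let $M^A$ be the fixed point algebra, let $e\in A$ be the distinguished projection, and let $E:M\to M^A$, $E(x)=e\cdot x$, be the canonical conditional expectation. Then the following are equivalent: (i) The action is saturated. (ii) $E:M\to M^A$ is of index-finite type with $Index(E)=(\dim A)1$.
   Context: **Finite dimensional Hopf $*$-algebra.** This is a finite dimensional $C^*$-algebra $A$ together with linear maps $\Delta:A\to A\otimes A$, $\epsilon:A\to\mathbb C$, $S:A\to A$ such that: (1) $\Delta$ and $\epsilon$ are $*$-homomorphisms and $S$ is a $*$-preserving antimultiplicative involution; (2) $\Delta(1)=1\otimes 1$, $\epsilon(1)=1$, $S(1)=1$; (3) $(\Delta\otimes \mathrm{id})\Delta=(\mathrm{id}\otimes\Delta)\Delta$; (4) $(\epsilon\otimes \mathrm{id})\Delta=\mathrm{id}=(\mathrm{id}\otimes\epsilon)\Delta$; (5) $m((S\otimes \mathrm{id})(\Delta(a)))=\epsilon(a)1=m((\mathrm{id}\otimes S)(\Delta(a)))$ for $a\in A$, where $m:A\otimes A\to A$ is multiplication. Write $\Delta(a)=\sum_i a_i^L\otimes a_i^R$. The distinguished projection $e\in A$ is the (unique) minimal central projection with $ae=\epsilon(a)e$ for all $a\in A$; it satisfies $\epsilon(e)=1$ and $S(e)=e$. $\dim A$ is the complex vector space dimension. **Action.** An action of $A$ on a unital $C^*$-algebra $M$ is a bilinear map $\cdot:A\times M\to M$ such that for $a,b\in A$, $x,y\in M$: $1\cdot x=x$, $a\cdot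 1=\epsilon(a)1$, $ab\cdot x=a\cdot(b\cdot x)$, $a\cdot(xy)=\sum_i(a_i^L\cdot x)(a_i^R\cdot y)$, $(a\cdot x)^*=S(a^* )\cdot x^*$. The fixed point algebra is $M^A=\{x\in M\mid a\cdot x=\epsilon(a)x \text{ for all } a\in A\}$. The map $E(x)=e\cdot x$ is a faithful conditional expectation of $M$ onto $M^A$. **Crossed product.** $M\rtimes A$ is the vector space $M\otimes A$ with multiplication $(x\otimes a)(y\otimes b)=\sum_i x(a_i^L\cdot y)\otimes a_i^Rb$ and involution $(x\otimes a)^*=\sum_i (a_i^L)^*\cdot x^*\otimes(a_i^R)^*$. Identify $a\in A$ with $1\otimes a$ and $x\in M$ with $x\otimes 1$. **Saturated.** The action is saturated if $M\rtimes A=\mathrm{span}\{xey\mid x,y\in M\}$. **Index-finite type.** A faithful conditional expectation $E:B\to C$ from a unital $C^*$-algebra $B$ onto a $C^*$-subalgebra $C$ containing the unit of $B$ is of index-finite type if there are finitely many $v_1,\dots,v_n\in B$ with $b=\sum_iE(bv_i)v_i^*=\sum_iv_iE(v_i^*b)$ for all $b\in B$; then $\{(v_i,v_i^* )\}$ is called a quasi-basis for $E$, and $Index(E)=\sum_iv_iv_i^*$, which is a central element of $B$ independent of the choice of quasi-basis. *)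

theory Defs
  imports "HOL-Analysis.Analysis" "HOL-Library.Multiset"
begin

section \<open>Complex vector spaces, unital star-algebras, unital \<open>C\<^sup>*\<close>-algebras\<close>

class complex_vector = ab_group_add +
  fixes scaleC :: "complex \<Rightarrow> 'a \<Rightarrow> 'a"  (infixr "*\<^sub>C" 75)
  assumes scaleC_add_right: "c *\<^sub>C (x + y) = c *\<^sub>C x + c *\<^sub>C y"
    and scaleC_add_left: "(c + d) *\<^sub>C x = c *\<^sub>C x + d *\<^sub>C x"
    and scaleC_scaleC: "c *\<^sub>C (d *\<^sub>C x) = (c * d) *\<^sub>C x"
    and scaleC_one: "1 *\<^sub>C x = x"

global_interpretation complex_vector: vector_space "scaleC :: complex \<Rightarrow> 'a \<Rightarrow> 'a::complex_vector"
  by unfold_locales (rule scaleC_add_right scaleC_add_left scaleC_scaleC scaleC_one)+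

abbreviation clinear :: "('a::complex_vector \<Rightarrow> 'b::complex_vector) \<Rightarrow> bool" where
  "clinear \<equiv> Vector_Spaces.linear scaleC scaleC"

lemma clinear_iff:
  "clinear f \<longleftrightarrow> (\<forall>x y. f (x + y) = f x + f y) \<and> (\<forall>c x. f (c *\<^sub>C x) = c *\<^sub>C f x)"
  by (simp add: Vector_Spaces.linear_iff complex_vector.vector_space_axioms)

definition cbilinear ::
  "('a::complex_vector \<Rightarrow> 'b::complex_vector \<Rightarrow> 'c::complex_vector) \<Rightarrow> bool" where
  "cbilinear f \<longleftrightarrow> (\<forall>x. clinear (f x)) \<and> (\<forall>y. clinear (\<lambda>x. f x y))"

text \<open>
  The classes contain \<open>monoid_mult\<close> rather than \<open>ring_1\<close>, so that the zero algebra is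
  not excluded.
\<close>

class star_algebra = complex_vector + ring + monoid_mult +
  fixes star :: "'a \<Rightarrow> 'a"
  assumes mult_scaleC_left: "(c *\<^sub>C x) * y = c *\<^sub>C (x * y)"
    and mult_scaleC_right: "x * (c *\<^sub>C y) = c *\<^sub>C (x * y)"
    and star_add: "star (x + y) = star x + star y"
    and star_scaleC: "star (c *\<^sub>C x) = cnj c *\<^sub>C star x"
    and star_mult: "star (x * y) = star y * star x"
    and star_star: "star (star x) = x"

class cstar_algebra = star_algebra + real_normed_algebra + banach +
  assumes scaleR_scaleC: "r *\<^sub>R x = complex_of_real r *\<^sub>C x"
    and norm_scaleC: "norm (c *\<^sub>C x) = cmod c * norm x"
    and norm_star_mult: "norm (star x * x) = (norm x)\<^sup>2"

instantiation complex :: cstar_algebra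
begin

definition "c *\<^sub>C (z::complex) = c * z"
definition "star (z::complex) = cnj z"

instance
  by standard (auto simp: scaleC_complex_def star_complex_def algebra_simps scaleR_conv_of_real
      norm_mult power2_eq_square)

end

definition star_hom :: "('a::star_algebra \<Rightarrow> 'b::star_algebra) \<Rightarrow> bool" where
  "star_hom f \<longleftrightarrow> clinear f \<and> (\<forall>x y. f (x * y) = f x * f y) \<and> (\<forall>x. f (star x) = star (f x))"


section \<open>The algebraic tensor product over the complex numbers\<close>

text \<open>
  A multiset of pairs stands for the formal sum of its elementary tensors.  Scalars are
  absorbed into either factor, and \<open>(- x, a)\<close> is the additive inverse of \<open>(x, a)\<close>, so the
  quotient by the congruence below is the usual tensor product of complex vector spaces.
  When one factor is finite dimensional, as in all uses below, no completion is needed.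
\<close>

inductive tensor_eq ::
  "('a::complex_vector \<times> 'b::complex_vector) multiset \<Rightarrow> ('a \<times> 'b) multiset \<Rightarrow> bool" where
  refl: "tensor_eq s s"
| sym: "tensor_eq s t \<Longrightarrow> tensor_eq t s"
| trans: "tensor_eq s t \<Longrightarrow> tensor_eq t u \<Longrightarrow> tensor_eq s u"
| plus: "tensor_eq s t \<Longrightarrow> tensor_eq s' t' \<Longrightarrow> tensor_eq (s + s') (t + t')"
| zero: "tensor_eq {#(0, a)#} {#}"
| left: "tensor_eq {#(x + y, a)#} {#(x, a), (y, a)#}"
| right: "tensor_eq {#(x, a + b)#} {#(x, a), (x, b)#}"
| scale: "tensor_eq {#(c *\<^sub>C x, a)#} {#(x, c *\<^sub>C a)#}"

lemma equivp_tensor_eq: "equivp tensor_eq"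
  by (intro equivpI reflpI sympI transpI) (auto intro: tensor_eq.intros)

quotient_type (overloaded) ('a, 'b) tensor =
  "('a::complex_vector \<times> 'b::complex_vector) multiset" / tensor_eq
  by (rule equivp_tensor_eq)

lift_definition pure_tensor ::
  "'a::complex_vector \<Rightarrow> 'b::complex_vector \<Rightarrow> ('a, 'b) tensor"  (infixr "\<otimes>\<^sub>C" 72)
  is "\<lambda>x a. {#(x, a)#}" .

lemma tensor_eq_image:
  assumes "tensor_eq s t"
    and f: "\<And>x y. f (x + y) = f x + f y" "f 0 = 0" "\<And>c x. f (c *\<^sub>C x) = h c *\<^sub>C f x"
    and g: "\<And>a b. g (a + b) = g a + g b" "\<And>c a. g (c *\<^sub>C a) = h c *\<^sub>C g a"
  shows "tensor_eq (image_mset (map_prod f g) s) (image_mset (map_prod f g) t)"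
  using assms(1) by induction (auto simp: f g intro: tensor_eq.intros)

instantiation tensor :: (complex_vector, complex_vector) complex_vector
begin

lift_definition zero_tensor :: "('a, 'b) tensor" is "{#}" .

lift_definition plus_tensor :: "('a, 'b) tensor \<Rightarrow> ('a, 'b) tensor \<Rightarrow> ('a, 'b) tensor"
  is "(+)" by (rule tensor_eq.plus)

lift_definition scaleC_tensor :: "complex \<Rightarrow> ('a, 'b) tensor \<Rightarrow> ('a, 'b) tensor"
  is "\<lambda>c. image_mset (map_prod (\<lambda>x. c *\<^sub>C x) id)"
  by (erule tensor_eq_image[where h = id])
     (auto simp: scaleC_add_right scaleC_scaleC mult.commute)

lift_definition uminus_tensor :: "('a, 'b) tensor \<Rightarrow> ('a, 'b) tensor"
  is "image_mset (map_prod uminus id)"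
  by (erule tensor_eq_image[where h = id]) auto

definition "s - t = s + - (t :: ('a, 'b) tensor)"

instance
proof
  fix s t u :: "('a, 'b) tensor" and c d :: complex
  show "s + t + u = s + (t + u)" by transfer (simp add: add.assoc tensor_eq.refl)
  show "s + t = t + s" by transfer (simp add: add.commute tensor_eq.refl)
  show "0 + s = s" by transfer (simp add: tensor_eq.refl)
  show "- s + s = 0"
  proof (transfer)
    fix s :: "('a \<times> 'b) multiset"
    show "tensor_eq (image_mset (map_prod uminus id) s + s) {#}"
    proof (induction s)
      case (add p s)
      obtain x a where p: "p = (x, a)" by (cases p)
      have "tensor_eq {#(- x, a), (x, a)#} {#(- x + x, a)#}"
        by (rule tensor_eq.sym, rule tensor_eq.left)
      then have "tensor_eq {#(- x, a), (x, a)#} {#}"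
        using tensor_eq.zero[of a] by (auto intro: tensor_eq.trans)
      from tensor_eq.plus[OF this add] show ?case by (simp add: p add_mset_commute)
    qed (simp add: tensor_eq.refl)
  qed
  show "s - t = s + - t" by (fact minus_tensor_def)
  show "c *\<^sub>C (s + t) = c *\<^sub>C s + c *\<^sub>C t" by transfer (simp add: tensor_eq.refl)
  show "(c + d) *\<^sub>C s = c *\<^sub>C s + d *\<^sub>C s"
  proof transfer
    fix s :: "('a \<times> 'b) multiset" and c d :: complex
    show "tensor_eq (image_mset (map_prod ((*\<^sub>C) (c + d)) id) s)
      (image_mset (map_prod ((*\<^sub>C) c) id) s + image_mset (map_prod ((*\<^sub>C) d) id) s)"
    proof (induction s)
      case (add p s)
      obtain x a where p: "p = (x, a)" by (cases p)
      have "tensor_eq {#((c + d) *\<^sub>C x, a)#} {#(c *\<^sub>C x, a), (d *\<^sub>C x, a)#}"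
        by (simp add: scaleC_add_left tensor_eq.left)
      from tensor_eq.plus[OF this add] show ?case by (simp add: p add_mset_commute)
    qed (simp add: tensor_eq.refl)
  qed
  show "c *\<^sub>C (d *\<^sub>C s) = (c * d) *\<^sub>C s"
  proof transfer
    fix s :: "('a \<times> 'b) multiset" and c d :: complex
    have "image_mset (map_prod ((*\<^sub>C) c) id) (image_mset (map_prod ((*\<^sub>C) d) id) s) =
      image_mset (map_prod ((*\<^sub>C) (c * d)) id) s"
      by (induction s) (auto simp: scaleC_scaleC)
    then show "tensor_eq (image_mset (map_prod ((*\<^sub>C) c) id) (image_mset (map_prod ((*\<^sub>C) d) id) s))
      (image_mset (map_prod ((*\<^sub>C) (c * d)) id) s)"
      by (simp add: tensor_eq.refl)
  qed
  show "1 *\<^sub>C s = s"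
    by transfer (simp add: tensor_eq.refl scaleC_one id_def map_prod_def)
qed

end

lemma tensor_add_left: "(x + y) \<otimes>\<^sub>C a = x \<otimes>\<^sub>C a + y \<otimes>\<^sub>C a"
  by transfer (auto intro: tensor_eq.left simp: add_mset_commute)

lemma tensor_add_right: "x \<otimes>\<^sub>C (a + b) = x \<otimes>\<^sub>C a + x \<otimes>\<^sub>C b"
  by transfer (auto intro: tensor_eq.right simp: add_mset_commute)

lemma tensor_scaleC_left: "(c *\<^sub>C x) \<otimes>\<^sub>C a = c *\<^sub>C (x \<otimes>\<^sub>C a)"
  by transfer (simp add: tensor_eq.refl)

lemma tensor_scaleC_right: "x \<otimes>\<^sub>C (c *\<^sub>C a) = c *\<^sub>C (x \<otimes>\<^sub>C a)"
  by transfer (simp add: tensor_eq.scale tensor_eq.sym)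

lemma tensor_induct [case_names zero pure plus, induct type: tensor]:
  assumes "P 0" "\<And>x a. P (x \<otimes>\<^sub>C a)" "\<And>s t. P s \<Longrightarrow> P t \<Longrightarrow> P (s + t)"
  shows "P (t :: ('a::complex_vector, 'b::complex_vector) tensor)"
  using assms
proof (transfer fixing: )
  fix P :: "('a \<times> 'b) multiset \<Rightarrow> bool" and t
  assume *: "P {#}" "\<And>x a. P {#(x, a)#}" "\<And>s t. P s \<Longrightarrow> P t \<Longrightarrow> P (s + t)"
  show "P t"
  proof (induction t)
    case (add p t)
    then have "P ({#p#} + t)" using *(2) *(3) by (cases p) blast
    then show ?case by simp
  qed (fact *)
qed

text \<open>
  The linear map on the tensor product induced by a bilinear map; it depends on the
  representative if \<open>f\<close> is not bilinear.
\<close>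

definition tensor_lift ::
  "('a::complex_vector \<Rightarrow> 'b::complex_vector \<Rightarrow> 'c::complex_vector) \<Rightarrow> ('a, 'b) tensor \<Rightarrow> 'c" where
  "tensor_lift f t = (\<Sum>(x, a)\<in>#rep_tensor t. f x a)"

lemma cbilinear_iff:
  "cbilinear f \<longleftrightarrow>
    (\<forall>x y a. f (x + y) a = f x a + f y a) \<and> (\<forall>x a b. f x (a + b) = f x a + f x b) \<and>
    (\<forall>c x a. f (c *\<^sub>C x) a = c *\<^sub>C f x a) \<and> (\<forall>c x a. f x (c *\<^sub>C a) = c *\<^sub>C f x a)"
  unfolding cbilinear_def clinear_iff by auto

lemma tensor_eq_sum:
  assumes "cbilinear f" "tensor_eq s t"
  shows "(\<Sum>(x, a)\<in>#s. f x a) = (\<Sum>(x, a)\<in>#t. f x a)"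
proof -
  have "f 0 a = 0" for a
  proof -
    have "f (0 + 0) a = f 0 a + f 0 a"
      using assms(1) unfolding cbilinear_iff by blast
    then show ?thesis by simp
  qed
  with assms(2) show ?thesis
    by induction (use assms(1) in \<open>auto simp: cbilinear_iff\<close>)
qed

lemma tensor_lift_abs:
  assumes "cbilinear f"
  shows "tensor_lift f (abs_tensor s) = (\<Sum>(x, a)\<in>#s. f x a)"
proof -
  have "tensor_eq (rep_tensor (abs_tensor s)) s"
    using Quotient3_rep_abs[OF Quotient3_tensor] tensor_eq.refl by blast
  then show ?thesis
    unfolding tensor_lift_def by (rule tensor_eq_sum[OF assms])
qed

lemma tensor_lift_pure: "cbilinear f \<Longrightarrow> tensor_lift f (x \<otimes>\<^sub>C a) = f x a"
  by (simp add: pure_tensor.abs_eq tensor_lift_abs)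

lemma tensor_lift_zero: "cbilinear f \<Longrightarrow> tensor_lift f 0 = 0"
  by (simp add: zero_tensor.abs_eq tensor_lift_abs)

lemma tensor_lift_add:
  "cbilinear f \<Longrightarrow> tensor_lift f (s + t) = tensor_lift f s + tensor_lift f t"
  by (induction s rule: tensor.abs_induct, induction t rule: tensor.abs_induct)
     (simp add: plus_tensor.abs_eq tensor_lift_abs)

lemma tensor_lift_scaleC:
  assumes "cbilinear f"
  shows "tensor_lift f (c *\<^sub>C t) = c *\<^sub>C tensor_lift f t"
proof (induction t)
  case (pure x a)
  have "tensor_lift f (c *\<^sub>C (x \<otimes>\<^sub>C a)) = f (c *\<^sub>C x) a"
    by (simp only: tensor_scaleC_left[symmetric] tensor_lift_pure[OF assms])
  then show ?case using assms by (simp add: tensor_lift_pure[OF assms]) (simp add: cbilinear_iff)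
qed (simp_all add: assms tensor_lift_zero tensor_lift_add scaleC_add_right)

lemma clinear_tensor_lift: "cbilinear f \<Longrightarrow> clinear (tensor_lift f)"
  by (simp add: clinear_iff tensor_lift_add tensor_lift_scaleC)

lemma tensor_lift_add_fun:
  "tensor_lift (\<lambda>x a. f x a + g x a) t = tensor_lift f t + tensor_lift g t"
proof -
  have "(\<Sum>(x, a)\<in>#s. f x a + g x a) = (\<Sum>(x, a)\<in>#s. f x a) + (\<Sum>(x, a)\<in>#s. g x a)" for s
    by (induction s) auto
  then show ?thesis unfolding tensor_lift_def .
qed

lemma tensor_lift_scaleC_fun:
  "tensor_lift (\<lambda>x a. c *\<^sub>C f x a) t = c *\<^sub>C tensor_lift f t"
proof -
  have "(\<Sum>(x, a)\<in>#s. c *\<^sub>C f x a) = c *\<^sub>C (\<Sum>(x, a)\<in>#s. f x a)" for s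
    by (induction s) (auto simp: scaleC_add_right)
  then show ?thesis unfolding tensor_lift_def .
qed

definition tensor_map ::
  "('a::complex_vector \<Rightarrow> 'c::complex_vector) \<Rightarrow> ('b::complex_vector \<Rightarrow> 'd::complex_vector) \<Rightarrow>
    ('a, 'b) tensor \<Rightarrow> ('c, 'd) tensor" where
  "tensor_map f g = tensor_lift (\<lambda>x a. f x \<otimes>\<^sub>C g a)"

definition tensor_assoc ::
  "(('a::complex_vector, 'b::complex_vector) tensor, 'c::complex_vector) tensor \<Rightarrow>
    ('a, ('b, 'c) tensor) tensor" where
  "tensor_assoc = tensor_lift (\<lambda>t c. tensor_lift (\<lambda>a b. a \<otimes>\<^sub>C (b \<otimes>\<^sub>C c)) t)"


subsection \<open>The tensor product of star-algebras\<close>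

lemma cbilinear_tensor_mult_inner:
  "cbilinear (\<lambda>y b. (x * y) \<otimes>\<^sub>C (a * b))" for x :: "'a::star_algebra" and a :: "'b::star_algebra"
  by (simp add: cbilinear_iff distrib_left mult_scaleC_right tensor_add_left tensor_add_right
      tensor_scaleC_left tensor_scaleC_right)

lemma cbilinear_tensor_mult_outer:
  "cbilinear (\<lambda>x a. tensor_lift (\<lambda>y b. (x * y) \<otimes>\<^sub>C (a * b)) t)"
  for t :: "('a::star_algebra, 'b::star_algebra) tensor"
  by (simp add: cbilinear_iff distrib_right mult_scaleC_left tensor_add_left tensor_add_right
      tensor_scaleC_left tensor_scaleC_right tensor_lift_scaleC_fun
      tensor_lift_add_fun)

instantiation tensor :: (star_algebra, star_algebra) star_algebra
begin

definition one_tensor :: "('a, 'b) tensor" where "1 = 1 \<otimes>\<^sub>C 1"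

definition times_tensor :: "('a, 'b) tensor \<Rightarrow> ('a, 'b) tensor \<Rightarrow> ('a, 'b) tensor" where
  "s * t = tensor_lift (\<lambda>x a. tensor_lift (\<lambda>y b. (x * y) \<otimes>\<^sub>C (a * b)) t) s"

lemma star_zero_aux: "star (0 :: 'c::star_algebra) = 0"
proof -
  have "star (0 + 0 :: 'c) = star 0 + star 0" by (rule star_add)
  then show ?thesis by simp
qed

lift_definition star_tensor :: "('a, 'b) tensor \<Rightarrow> ('a, 'b) tensor"
  is "image_mset (map_prod star star)"
  by (erule tensor_eq_image[where h = cnj]) (auto simp: star_add star_scaleC star_zero_aux)

lemma tensor_mult_pure: "(x \<otimes>\<^sub>C a) * (y \<otimes>\<^sub>C b) = (x * y) \<otimes>\<^sub>C (a * b)"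
  for x :: 'a and a :: 'b
  unfolding times_tensor_def
  by (subst tensor_lift_pure[OF cbilinear_tensor_mult_outer])
     (rule tensor_lift_pure[OF cbilinear_tensor_mult_inner])

lemma star_tensor_pure: "star (x \<otimes>\<^sub>C a) = star x \<otimes>\<^sub>C star a"
  for x :: 'a and a :: 'b
  by transfer (simp add: tensor_eq.refl)

instance
proof
  have addl: "(s + t) * u = s * u + t * u" for s t u :: "('a, 'b) tensor"
    by (simp add: times_tensor_def tensor_lift_add cbilinear_tensor_mult_outer)
  have addr: "u * (s + t) = u * s + u * t" for s t u :: "('a, 'b) tensor"
    unfolding times_tensor_def
    by (simp add: tensor_lift_add cbilinear_tensor_mult_inner tensor_lift_add_fun
        cbilinear_tensor_mult_outer)
  have zl: "0 * s = 0" for s :: "('a, 'b) tensor"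
    using addl[of 0 0 s] by simp
  have zr: "s * 0 = 0" for s :: "('a, 'b) tensor"
    using addr[of s 0 0] by simp
  have sadd: "star (s + t) = star s + star t" for s t :: "('a, 'b) tensor"
    by transfer (simp add: tensor_eq.refl)
  have szero: "star (0 :: ('a, 'b) tensor) = 0"
    by transfer (simp add: tensor_eq.refl)
  have cl: "(c *\<^sub>C s) * t = c *\<^sub>C (s * t)" for c and s t :: "('a, 'b) tensor"
    by (simp add: times_tensor_def tensor_lift_scaleC cbilinear_tensor_mult_outer)
  have cr: "s * (c *\<^sub>C t) = c *\<^sub>C (s * t)" for c and s t :: "('a, 'b) tensor"
    by (simp add: times_tensor_def tensor_lift_scaleC cbilinear_tensor_mult_inner
        tensor_lift_scaleC_fun)
  fix s t u :: "('a, 'b) tensor" and c :: complex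
  show "(s + t) * u = s * u + t * u" "u * (s + t) = u * s + u * t"
    "(c *\<^sub>C s) * t = c *\<^sub>C (s * t)" "s * (c *\<^sub>C t) = c *\<^sub>C (s * t)"
    "star (s + t) = star s + star t"
    by (fact addl addr cl cr sadd)+
  show "s * t * u = s * (t * u)"
  proof (induction s)
    case (pure x a)
    show ?case
    proof (induction t)
      case (pure y b)
      show ?case
        by (induction u) (simp_all add: tensor_mult_pure mult.assoc addr zr)
    qed (simp_all add: addl addr zl zr)
  qed (simp_all add: addl zl)
  show "1 * s = s"
    by (induction s) (simp_all add: one_tensor_def tensor_mult_pure addr zr)
  show "s * 1 = s"
    by (induction s) (simp_all add: one_tensor_def tensor_mult_pure addl zl)
  show "star (c *\<^sub>C s) = cnj c *\<^sub>C star s"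
  proof (induction s)
    case (pure x a)
    show ?case
      by (simp add: tensor_scaleC_left[symmetric] star_tensor_pure star_scaleC)
  qed (simp_all add: scaleC_add_right sadd szero)
  show "star (s * t) = star t * star s"
  proof (induction s)
    case (pure x a)
    show ?case
      by (induction t)
         (simp_all add: tensor_mult_pure star_tensor_pure star_mult addl addr zl zr sadd szero)
  qed (simp_all add: addl addr zl zr sadd szero)
  show "star (star s) = s"
    by (induction s) (simp_all add: star_tensor_pure star_star sadd szero)
qed

end


section \<open>Finite dimensional Hopf star-algebras and their actions\<close>

locale hopf_star_algebra =
  fixes \<Delta> :: "'a::cstar_algebra \<Rightarrow> ('a, 'a) tensor"
    and \<epsilon> :: "'a \<Rightarrow> complex"
    and S :: "'a \<Rightarrow> 'a"
  assumes finite_dim: "\<exists>B :: 'a set. finite B \<and> complex_vector.span B = UNIV"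
    and Delta_hom: "star_hom \<Delta>"
    and eps_hom: "star_hom \<epsilon>"
    and S_linear: "clinear S"
    and S_star: "S (star a) = star (S a)"
    and S_antimult: "S (a * b) = S b * S a"
    and S_S: "S (S a) = a"
    and Delta_one: "\<Delta> 1 = 1 \<otimes>\<^sub>C 1"
    and eps_one: "\<epsilon> 1 = 1"
    and S_one: "S 1 = 1"
    and coassoc: "tensor_assoc (tensor_map \<Delta> id (\<Delta> a)) = tensor_map id \<Delta> (\<Delta> a)"
    \<comment> \<open>scalar multiplication identifies \<open>\<complex> \<otimes> A\<close> and \<open>A \<otimes> \<complex>\<close> with \<open>A\<close>\<close>
    and counit_left: "tensor_lift (\<lambda>c b. c *\<^sub>C b) (tensor_map \<epsilon> id (\<Delta> a)) = a"
    and counit_right: "tensor_lift (\<lambda>b c. c *\<^sub>C b) (tensor_map id \<epsilon> (\<Delta> a)) = a"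
    and antipode_left: "tensor_lift (*) (tensor_map S id (\<Delta> a)) = \<epsilon> a *\<^sub>C 1"
    and antipode_right: "tensor_lift (*) (tensor_map id S (\<Delta> a)) = \<epsilon> a *\<^sub>C 1"

definition central_projection :: "'a::star_algebra \<Rightarrow> bool" where
  "central_projection p \<longleftrightarrow> p * p = p \<and> star p = p \<and> (\<forall>a. a * p = p * a)"

definition minimal_central_projection :: "'a::star_algebra \<Rightarrow> bool" where
  "minimal_central_projection p \<longleftrightarrow> central_projection p \<and> p \<noteq> 0 \<and>
    (\<forall>q. central_projection q \<and> q * p = q \<longrightarrow> q = 0 \<or> q = p)"

definition distinguished_projection :: "('a::star_algebra \<Rightarrow> complex) \<Rightarrow> 'a \<Rightarrow> bool" where
  "distinguished_projection \<epsilon> e \<longleftrightarrow>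
    minimal_central_projection e \<and> (\<forall>a. a * e = \<epsilon> a *\<^sub>C e)"

lemma distinguished_projection_unique:
  assumes "distinguished_projection \<epsilon> e" "distinguished_projection \<epsilon> f"
  shows "e = f"
proof -
  have *: "p * q = q" if "distinguished_projection \<epsilon> p" "distinguished_projection \<epsilon> q" for p q
  proof -
    have p: "p * p = p" "p \<noteq> 0" "\<And>a. a * p = \<epsilon> a *\<^sub>C p" and q: "\<And>a. a * q = \<epsilon> a *\<^sub>C q"
      using that unfolding distinguished_projection_def minimal_central_projection_def
        central_projection_def by blast+
    have "\<epsilon> p *\<^sub>C p = 1 *\<^sub>C p"
      by (simp only: p(3)[symmetric] p(1) scaleC_one)
    then have "\<epsilon> p = 1"
      using p(2) by (simp only: complex_vector.scale_cancel_right) simp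
    then show ?thesis by (simp only: q scaleC_one)
  qed
  have "e * f = f * e"
    using assms(2) unfolding distinguished_projection_def minimal_central_projection_def
      central_projection_def by blast
  then show ?thesis using *[OF assms] *[OF assms(2,1)] by metis
qed

locale hopf_action = hopf_star_algebra \<Delta> \<epsilon> S
  for \<Delta> :: "'a::cstar_algebra \<Rightarrow> ('a, 'a) tensor"
    and \<epsilon> :: "'a \<Rightarrow> complex"
    and S :: "'a \<Rightarrow> 'a" +
  fixes act :: "'a \<Rightarrow> 'm::cstar_algebra \<Rightarrow> 'm"
  assumes act_bilinear: "cbilinear act"
    and act_one_left: "act 1 x = x"
    and act_one_right: "act a 1 = \<epsilon> a *\<^sub>C 1"
    and act_mult_left: "act (a * b) x = act a (act b x)"
    and act_mult_right:
      "act a (x * y) = tensor_lift (\<lambda>a_L a_R. act a_L x * act a_R y) (\<Delta> a)"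
    and act_star: "star (act a x) = act (S (star a)) (star x)"

definition fixed_point_algebra ::
  "('a \<Rightarrow> complex) \<Rightarrow> ('a \<Rightarrow> 'm \<Rightarrow> 'm) \<Rightarrow> 'm::complex_vector set" where
  "fixed_point_algebra \<epsilon> act = {x. \<forall>a. act a x = \<epsilon> a *\<^sub>C x}"

text \<open>
  The multiplication of the crossed product, whose underlying vector space is the type
  \<open>('m, 'a) tensor\<close>; on elementary tensors, \<open>(x \<otimes> a) (y \<otimes> b)\<close> is the sum of
  \<open>x (a_L \<cdot> y) \<otimes> a_R b\<close> over \<open>\<Delta> a\<close>.  It is unrelated to the multiplication of the
  tensor product algebra.
\<close>

definition crossed_mult ::
  "('a \<Rightarrow> ('a, 'a) tensor) \<Rightarrow> ('a \<Rightarrow> 'm \<Rightarrow> 'm) \<Rightarrow>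
    ('m::star_algebra, 'a::star_algebra) tensor \<Rightarrow> ('m, 'a) tensor \<Rightarrow> ('m, 'a) tensor" where
  "crossed_mult \<Delta> act s t =
    tensor_lift (\<lambda>x a. tensor_lift (\<lambda>y b.
      tensor_lift (\<lambda>a_L a_R. (x * act a_L y) \<otimes>\<^sub>C (a_R * b)) (\<Delta> a)) t) s"

definition saturated ::
  "('a \<Rightarrow> ('a, 'a) tensor) \<Rightarrow> ('a \<Rightarrow> 'm \<Rightarrow> 'm::star_algebra) \<Rightarrow> 'a::star_algebra \<Rightarrow> bool" where
  "saturated \<Delta> act e \<longleftrightarrow>
    (UNIV :: ('m, 'a) tensor set) =
      complex_vector.span
        {crossed_mult \<Delta> act (crossed_mult \<Delta> act (x \<otimes>\<^sub>C 1) (1 \<otimes>\<^sub>C e)) (y \<otimes>\<^sub>C 1) | x y. True}"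

context hopf_action
begin

lemma act_add_left: "act (a + b) x = act a x + act b x"
  and act_add_right: "act a (x + y) = act a x + act a y"
  and act_scaleC_left: "act (c *\<^sub>C a) x = c *\<^sub>C act a x"
  and act_scaleC_right: "act a (c *\<^sub>C x) = c *\<^sub>C act a x"
  using act_bilinear by (simp_all add: cbilinear_iff)

lemma cbilinear_crossed_1: "cbilinear (\<lambda>a_L a_R. (x * act a_L y) \<otimes>\<^sub>C (a_R * b))" for b :: 'a
  by (simp add: cbilinear_iff distrib_left distrib_right mult_scaleC_left mult_scaleC_right
      tensor_add_left tensor_add_right tensor_scaleC_left tensor_scaleC_right
      act_add_left act_scaleC_left)

lemma cbilinear_crossed_2:
  "cbilinear (\<lambda>y b. tensor_lift (\<lambda>a_L a_R. (x * act a_L y) \<otimes>\<^sub>C (a_R * b)) (\<Delta> a))"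
  by (simp add: cbilinear_iff distrib_left distrib_right mult_scaleC_left mult_scaleC_right
      tensor_add_left tensor_add_right tensor_scaleC_left tensor_scaleC_right
      act_add_right act_scaleC_right tensor_lift_scaleC_fun
      tensor_lift_add_fun)

lemma cbilinear_crossed_3:
  "cbilinear (\<lambda>x a. tensor_lift (\<lambda>y b.
     tensor_lift (\<lambda>a_L a_R. (x * act a_L y) \<otimes>\<^sub>C (a_R * b)) (\<Delta> a)) t)"
proof -
  have \<Delta>: "\<Delta> (a + b) = \<Delta> a + \<Delta> b" "\<Delta> (c *\<^sub>C a) = c *\<^sub>C \<Delta> a" for a b c
    using Delta_hom by (simp_all add: star_hom_def clinear_iff)
  show ?thesis
    unfolding cbilinear_iff
    by (simp add: \<Delta> distrib_right mult_scaleC_left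
        tensor_add_left tensor_scaleC_left tensor_lift_add tensor_lift_scaleC
        cbilinear_crossed_1 tensor_lift_scaleC_fun tensor_lift_add_fun)
qed

lemma crossed_mult_pure:
  "crossed_mult \<Delta> act (x \<otimes>\<^sub>C a) (y \<otimes>\<^sub>C b) =
    tensor_lift (\<lambda>a_L a_R. (x * act a_L y) \<otimes>\<^sub>C (a_R * b)) (\<Delta> a)"
  unfolding crossed_mult_def
  by (subst tensor_lift_pure[OF cbilinear_crossed_3])
     (rule tensor_lift_pure[OF cbilinear_crossed_2])

end


section \<open>Conditional expectations of index-finite type\<close>

definition cstar_subalgebra :: "'b::cstar_algebra set \<Rightarrow> bool" where
  "cstar_subalgebra C \<longleftrightarrow> complex_vector.subspace C \<and> (\<forall>x\<in>C. \<forall>y\<in>C. x * y \<in> C) \<and>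
    (\<forall>x\<in>C. star x \<in> C) \<and> closed C"

definition positive_element :: "'b::star_algebra \<Rightarrow> bool" where
  "positive_element y \<longleftrightarrow> (\<exists>z. y = star z * z)"

definition faithful_conditional_expectation ::
  "('b::cstar_algebra \<Rightarrow> 'b) \<Rightarrow> 'b set \<Rightarrow> bool" where
  "faithful_conditional_expectation E C \<longleftrightarrow>
    cstar_subalgebra C \<and> 1 \<in> C \<and> clinear E \<and> range E = C \<and> (\<forall>c\<in>C. E c = c) \<and>
    (\<forall>c\<in>C. \<forall>d\<in>C. \<forall>x. E (c * x * d) = c * E x * d) \<and>
    (\<forall>x. positive_element (E (star x * x))) \<and>
    (\<forall>x. E (star x * x) = 0 \<longrightarrow> x = 0)"

text \<open>A list \<open>[v\<^sub>1, \<dots>, v\<^sub>n]\<close> stands for the pairs \<open>(v\<^sub>i, star v\<^sub>i)\<close>.\<close>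

definition quasi_basis :: "('b::star_algebra \<Rightarrow> 'b) \<Rightarrow> 'b list \<Rightarrow> bool" where
  "quasi_basis E vs \<longleftrightarrow>
    (\<forall>b. b = (\<Sum>v\<leftarrow>vs. E (b * v) * star v) \<and> b = (\<Sum>v\<leftarrow>vs. v * E (star v * b)))"

definition index_finite_type :: "('b::cstar_algebra \<Rightarrow> 'b) \<Rightarrow> 'b set \<Rightarrow> bool" where
  "index_finite_type E C \<longleftrightarrow> faithful_conditional_expectation E C \<and> (\<exists>vs. quasi_basis E vs)"

definition Index :: "('b::star_algebra \<Rightarrow> 'b) \<Rightarrow> 'b" where
  "Index E = (THE z. \<exists>vs. quasi_basis E vs \<and> z = (\<Sum>v\<leftarrow>vs. v * star v))"

lemma quasi_basis_sum_unique:
  assumes vs: "quasi_basis E vs" and ws: "quasi_basis E ws"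
  shows "(\<Sum>v\<leftarrow>vs. v * star v) = (\<Sum>w\<leftarrow>ws. w * star w)"
proof -
  have v: "(\<Sum>v\<leftarrow>vs. v * E (star v * b)) = b" for b
    using vs unfolding quasi_basis_def by metis
  have w: "(\<Sum>w\<leftarrow>ws. E (b * w) * star w) = b" for b
    using ws unfolding quasi_basis_def by metis
  have "(\<Sum>w\<leftarrow>ws. w * star w) = (\<Sum>w\<leftarrow>ws. (\<Sum>v\<leftarrow>vs. v * E (star v * w)) * star w)"
    by (simp only: v)
  also have "\<dots> = (\<Sum>w\<leftarrow>ws. \<Sum>v\<leftarrow>vs. v * (E (star v * w) * star w))"
    by (simp add: sum_list_mult_const[symmetric] mult.assoc)
  also have "\<dots> = (\<Sum>v\<leftarrow>vs. \<Sum>w\<leftarrow>ws. v * (E (star v * w) * star w))"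
    by (induction ws) (simp_all add: sum_list_addf)
  also have "\<dots> = (\<Sum>v\<leftarrow>vs. v * (\<Sum>w\<leftarrow>ws. E (star v * w) * star w))"
    by (simp add: sum_list_const_mult)
  also have "\<dots> = (\<Sum>v\<leftarrow>vs. v * star v)"
    by (simp only: w)
  finally show ?thesis by simp
qed

lemma Index_eq: "quasi_basis E vs \<Longrightarrow> Index E = (\<Sum>v\<leftarrow>vs. v * star v)"
  unfolding Index_def by (rule the_equality) (use quasi_basis_sum_unique in blast)+

end

theory Submission
  imports Defs "Jordan_Normal_Form.Schur_Decomposition"
begin

text \<open>
  The trace \<open>\<tau>\<close> of the left regular representation of \<open>A\<close> is a faithful positive trace, and
  \<open>\<Sum> \<tau>(e\<^sub>2 x) S(e\<^sub>1) = x\<close> for all \<open>x\<close>, where \<open>\<Delta> e = \<Sum> e\<^sub>1 \<otimes> e\<^sub>2\<close>.  Hence a \<open>\<tau>\<close>-orthonormal basis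
  \<open>G\<close> of \<open>A\<close> diagonalises \<open>\<Delta> e = \<Sum>\<^sub>g S(g\<^sup>*) \<otimes> g\<close>, so that \<open>E(x\<^sup>* y) = \<Sum>\<^sub>g (g \<cdot> x)\<^sup>* (g \<cdot> y)\<close> and
  \<open>x e y\<^sup>* = \<Sum>\<^sub>g x (g \<cdot> y)\<^sup>* \<otimes> g\<close> in the crossed product.

  If the action is saturated, then \<open>1 = \<Sum> x\<^sub>i e y\<^sub>i\<close>; comparing coefficients shows that
  \<open>b = \<Sum> x\<^sub>i E(y\<^sub>i b)\<close> and \<open>\<Sum> x\<^sub>i y\<^sub>i = \<tau>(1) 1\<close>.  Polarisation writes this identity as a difference
  \<open>\<Sum> v E(v\<^sup>* b) - \<Sum> w E(w\<^sup>* b)\<close>, and the negative terms are removed one at a time with inverse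
  square roots of rank-one perturbations of the identity, which yields a quasi-basis.

  Conversely, for a quasi-basis of index \<open>\<tau>(1) 1\<close> the coefficients \<open>p\<^sub>g\<close> of \<open>\<Sum> v e v\<^sup>*\<close> and
  \<open>\<lambda>\<^sub>g = \<tau>(g\<^sup>*)\<close> of the unit satisfy \<open>\<Sum> (p\<^sub>g - \<lambda>\<^sub>g) (p\<^sub>g - \<lambda>\<^sub>g)\<^sup>* = 0\<close>, so \<open>1 = \<Sum> v e v\<^sup>*\<close>.
\<close>

section \<open>Positivity in \<open>C\<^sup>*\<close>-algebras\<close>

lemma star_zero [simp]: "star (0::'a::star_algebra) = 0"
  using star_add[of 0 "0::'a"] by simp

lemma star_minus: "star (- x) = - star (x::'a::star_algebra)"
  using star_add[of x "- x"] by (simp add: add_eq_0_iff)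

lemma star_diff: "star (x - y) = star x - star (y::'a::star_algebra)"
  using star_add[of x "- y"] by (simp add: star_minus)

lemma star_one [simp]: "star (1::'a::star_algebra) = 1"
  using star_mult[of "star 1" "1::'a"] by (simp add: star_star)

lemma star_sum: "star (sum f A) = (\<Sum>i\<in>A. star (f i :: 'a::star_algebra))"
  by (induction A rule: infinite_finite_induct) (auto simp: star_add)

lemma star_sum_list: "star (\<Sum>v\<leftarrow>vs. f v) = (\<Sum>v\<leftarrow>vs. star (f v :: 'a::star_algebra))"
  by (induction vs) (auto simp: star_add)

lemma star_scaleR: "star (r *\<^sub>R x) = r *\<^sub>R star (x::'a::cstar_algebra)"
  by (simp add: scaleR_scaleC star_scaleC)

lemma norm_star [simp]: "norm (star x) = norm (x::'a::cstar_algebra)"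
proof -
  have *: "norm x \<le> norm (star x)" for x :: 'a
  proof (cases "x = 0")
    case False
    have "norm x * norm x = norm (star x * x)" by (simp add: norm_star_mult power2_eq_square)
    also have "\<dots> \<le> norm (star x) * norm x" by (rule norm_mult_ineq)
    finally show ?thesis using False by simp
  qed simp
  show ?thesis using *[of x] *[of "star x"] by (simp add: star_star)
qed

lemma norm_one_le: "norm (1::'a::cstar_algebra) \<le> 1"
proof -
  have "norm (1::'a) = norm (1::'a) * norm (1::'a)"
    using norm_star_mult[of "1::'a"] by (simp add: power2_eq_square)
  then show ?thesis by (cases "norm (1::'a) = 0") auto
qed

lemma norm_power_le: "norm (x ^ n) \<le> norm (x::'a::cstar_algebra) ^ n"
proof (induction n)
  case (Suc n)
  have "norm (x ^ Suc n) \<le> norm x * norm (x ^ n)"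
    by (simp add: norm_mult_ineq)
  also have "\<dots> \<le> norm x * norm x ^ n" by (intro mult_left_mono Suc) simp
  finally show ?case by simp
qed (simp add: norm_one_le)

lemma norm_square_self_adjoint: "star x = x \<Longrightarrow> norm (x * x) = (norm (x::'a::cstar_algebra))\<^sup>2"
  using norm_star_mult[of x] by simp

lemma star_mult_eq_0_iff: "star x * x = 0 \<longleftrightarrow> x = (0::'a::cstar_algebra)"
  using norm_star_mult[of x] by auto

lemma bounded_linear_star: "bounded_linear (star :: 'a::cstar_algebra \<Rightarrow> 'a)"
  by (rule bounded_linear_intro[where K=1]) (auto simp: star_add star_scaleR)

text \<open>For self-adjoint \<open>a\<close> the condition says that the spectrum lies in [0, 2t].
  Stated through the norm, positivity can be handled by estimates, with no spectral theory.\<close>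

definition norm_positive :: "'a::cstar_algebra \<Rightarrow> bool" where
  "norm_positive a \<longleftrightarrow> star a = a \<and> (\<exists>t>0. norm (t *\<^sub>R 1 - a) \<le> t)"

definition unital_subalgebra :: "'a::cstar_algebra set \<Rightarrow> bool" where
  "unital_subalgebra C \<longleftrightarrow> cstar_subalgebra C \<and> 1 \<in> C"

lemma unital_subalgebra_simps:
  assumes "unital_subalgebra C"
  shows "1 \<in> C" "0 \<in> C" "closed C"
    "x \<in> C \<Longrightarrow> y \<in> C \<Longrightarrow> x + y \<in> C" "x \<in> C \<Longrightarrow> y \<in> C \<Longrightarrow> x - y \<in> C"
    "x \<in> C \<Longrightarrow> y \<in> C \<Longrightarrow> x * y \<in> C" "x \<in> C \<Longrightarrow> r *\<^sub>R x \<in> C" "x \<in> C \<Longrightarrow> - x \<in> C"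
    "x \<in> C \<Longrightarrow> star x \<in> C"
  using assms
  by (auto simp: unital_subalgebra_def cstar_subalgebra_def scaleR_scaleC
      complex_vector.subspace_0 complex_vector.subspace_add complex_vector.subspace_diff
      complex_vector.subspace_neg complex_vector.subspace_scale)

text \<open>The fixed point \<open>y = (c + y\<^sup>2) / 2\<close> is the root \<open>1 - y\<close> of \<open>1 - c\<close>.\<close>

fun root_approx :: "'a::cstar_algebra \<Rightarrow> nat \<Rightarrow> 'a" where
  "root_approx c 0 = 0"
| "root_approx c (Suc n) = (1/2) *\<^sub>R (c + root_approx c n * root_approx c n)"

text \<open>The scalar iteration for \<open>c = 1\<close>. It is increasing and bounded by 1, and it
  dominates the norms and the increments of \<open>root_approx c\<close> when
  \<open>norm c \<le> 1\<close>.\<close>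

fun root_majorant :: "nat \<Rightarrow> real" where
  "root_majorant 0 = 0"
| "root_majorant (Suc n) = (1/2) * (1 + root_majorant n * root_majorant n)"

lemma root_majorant_bounds: "0 \<le> root_majorant n \<and> root_majorant n \<le> 1"
  by (induction n) (auto intro!: mult_le_one add_nonneg_nonneg mult_nonneg_nonneg)

lemma root_majorant_mono: "root_majorant n \<le> root_majorant (Suc n)"
proof -
  have "0 \<le> (1 - root_majorant n)\<^sup>2" by simp
  then show ?thesis by (simp add: power2_eq_square algebra_simps)
qed

lemma convergent_root_majorant: "convergent root_majorant"
proof (rule Bseq_mono_convergent)
  show "Bseq root_majorant"
    using root_majorant_bounds by (intro BseqI'[of _ 1]) (simp add: abs_le_iff)
  show "\<forall>m n. m \<le> n \<longrightarrow> root_majorant m \<le> root_majorant n"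
    using root_majorant_mono lift_Suc_mono_le by blast
qed

lemma root_approx_commute: "z * c = c * z \<Longrightarrow> z * root_approx c n = root_approx c n * z"
proof (induction n)
  case (Suc n)
  have "z * (root_approx c n * root_approx c n) = (root_approx c n * root_approx c n) * z"
    using Suc by (metis mult.assoc)
  then show ?case using Suc by (simp add: distrib_left distrib_right)
qed simp

lemma root_approx_self_adjoint: "star c = c \<Longrightarrow> star (root_approx c n) = root_approx c n"
  by (induction n) (auto simp: star_add star_scaleR star_mult)

lemma root_approx_mem: "unital_subalgebra C \<Longrightarrow> c \<in> C \<Longrightarrow> root_approx c n \<in> C"
  by (induction n) (auto simp del: scaleR_half_double intro!: unital_subalgebra_simps)

lemma norm_root_approx:
  assumes "norm c \<le> 1"
  shows "norm (root_approx c n) \<le> root_majorant n"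
proof (induction n)
  case (Suc n)
  have "norm (root_approx c n * root_approx c n) \<le> norm (root_approx c n) * norm (root_approx c n)"
    by (rule norm_mult_ineq)
  also have "\<dots> \<le> root_majorant n * root_majorant n"
    by (intro mult_mono Suc) (use root_majorant_bounds in auto)
  finally have "norm (c + root_approx c n * root_approx c n) \<le> 1 + root_majorant n * root_majorant n"
    using norm_triangle_mono assms by blast
  then show ?case by simp
qed simp

text \<open>Consecutive iterates commute, so the difference of their squares factors as a sum times
  a difference. The majorant obeys the same factorisation with equality.\<close>

lemma norm_root_approx_step:
  assumes "norm c \<le> 1"
  shows "norm (root_approx c (Suc n) - root_approx c n) \<le> root_majorant (Suc n) - root_majorant n"
proof (induction n)
  case (Suc n)
  let ?y = "root_approx c n" and ?z = "root_approx c (Suc n)"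
  let ?p = "root_majorant n" and ?q = "root_majorant (Suc n)"
  have comm: "?z * ?y = ?y * ?z"
    by (rule root_approx_commute, rule HOL.sym, rule root_approx_commute) (rule HOL.refl)
  have "root_approx c (Suc (Suc n)) - ?z = (1/2) *\<^sub>R (?z * ?z - ?y * ?y)"
    by (simp only: root_approx.simps(2)[of c "Suc n"] root_approx.simps(2)[of c n]
        scaleR_diff_right[symmetric]) (simp del: root_approx.simps)
  also have "?z * ?z - ?y * ?y = (?z + ?y) * (?z - ?y)"
    using comm by (simp add: algebra_simps del: root_approx.simps)
  finally have "norm (root_approx c (Suc (Suc n)) - ?z) \<le> (1/2) * (norm (?z + ?y) * norm (?z - ?y))"
    using norm_mult_ineq[of "?z + ?y" "?z - ?y"] by (simp del: root_approx.simps)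
  also have "\<dots> \<le> (1/2) * ((?q + ?p) * (?q - ?p))"
    using norm_root_approx[OF assms, of n] norm_root_approx[OF assms, of "Suc n"]
    by (intro mult_left_mono mult_mono Suc norm_triangle_mono)
       (use root_majorant_bounds in \<open>auto simp del: root_approx.simps root_majorant.simps
         intro: order_trans[OF norm_ge_zero]\<close>)
  also have "\<dots> = root_majorant (Suc (Suc n)) - ?q"
    by (simp only: root_majorant.simps(2)[of "Suc n"] root_majorant.simps(2)[of n])
       (simp add: algebra_simps)
  finally show ?case .
qed (use assms in simp)

text \<open>The bounds on the increments telescope, so the iterates are Cauchy because the majorant
  is.\<close>

lemma convergent_root_approx:
  assumes "norm c \<le> 1"
  shows "convergent (root_approx c)"
proof -
  have le: "norm (root_approx c m - root_approx c n) \<le> \<bar>root_majorant m - root_majorant n\<bar>"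
    if "n \<le> m" for m n
    using that
  proof (induction m rule: dec_induct)
    case (step m)
    have mono: "root_majorant n \<le> root_majorant m"
      using step root_majorant_mono lift_Suc_mono_le by blast
    have "norm (root_approx c (Suc m) - root_approx c n)
      \<le> norm (root_approx c (Suc m) - root_approx c m) + norm (root_approx c m - root_approx c n)"
      using norm_triangle_ineq[of "root_approx c (Suc m) - root_approx c m" "root_approx c m - root_approx c n"]
      by (simp del: root_approx.simps)
    then show ?case
      using step norm_root_approx_step[OF assms, of m] mono root_majorant_mono[of m] by linarith
  qed simp
  have "Cauchy root_majorant" using convergent_root_majorant by (rule convergent_Cauchy)
  then have "Cauchy (root_approx c)"
    unfolding Cauchy_def dist_norm real_norm_def
    by (smt (verit) le nle_le norm_minus_commute abs_minus_commute)
  then show ?thesis by (rule Cauchy_convergent)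
qed

text \<open>Every iterate is a real polynomial in \<open>c\<close>. Hence self-adjointness,
  commutation with the commutant of \<open>c\<close>, and membership in closed unital subalgebras
  containing \<open>c\<close> pass to the limit \<open>y\<close>.\<close>

lemma root_one_minus:
  fixes c :: "'a::cstar_algebra"
  assumes "star c = c" "norm c \<le> 1"
  obtains y where "star y = y" "norm y \<le> 1" "(1 - y) * (1 - y) = 1 - c"
    "\<forall>z. z * c = c * z \<longrightarrow> z * y = y * z"
    "\<forall>C. unital_subalgebra C \<and> c \<in> C \<longrightarrow> y \<in> C"
proof -
  obtain y where y: "root_approx c \<longlonglongrightarrow> y"
    using convergent_root_approx[OF assms(2)] by (auto simp: convergent_def)
  have "root_approx c (Suc n) = (1/2) *\<^sub>R (c + root_approx c n * root_approx c n)" for n by simp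
  then have "(\<lambda>n. root_approx c (Suc n)) \<longlonglongrightarrow> (1/2) *\<^sub>R (c + y * y)"
    by (simp only:) (intro tendsto_intros y)
  then have "y = (1/2) *\<^sub>R (c + y * y)"
    using LIMSEQ_Suc[OF y] LIMSEQ_unique by blast
  then have "2 *\<^sub>R y = 2 *\<^sub>R ((1/2) *\<^sub>R (c + y * y))" by (rule arg_cong)
  then have "2 *\<^sub>R y = c + y * y" by simp
  then have eq: "(1 - y) * (1 - y) = 1 - c" by (simp add: algebra_simps scaleR_2)
  have "star y = y"
    using bounded_linear.tendsto[OF bounded_linear_star y] y LIMSEQ_unique
    by (simp add: root_approx_self_adjoint[OF assms(1)])
  moreover have "norm y \<le> 1"
    by (rule Lim_bounded[OF tendsto_norm[OF y]])
       (use norm_root_approx[OF assms(2)] root_majorant_bounds order_trans in blast)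
  moreover note eq
  moreover have "z * y = y * z" if "z * c = c * z" for z
  proof -
    have "(\<lambda>n. z * root_approx c n) \<longlonglongrightarrow> z * y" "(\<lambda>n. root_approx c n * z) \<longlonglongrightarrow> y * z"
      by (intro tendsto_intros y)+
    then show ?thesis using root_approx_commute[OF that] LIMSEQ_unique by simp
  qed
  moreover have "y \<in> C" if "unital_subalgebra C" "c \<in> C" for C
    using closed_sequentially[OF unital_subalgebra_simps(3)[OF that(1)]] root_approx_mem[OF that] y
    by blast
  ultimately show ?thesis using that by blast
qed

text \<open>The element \<open>c = 1 - a / t\<close> has norm at most 1, so
  \<open>a / t = 1 - c\<close> has the root \<open>1 - y\<close>, which is rescaled by
  \<open>sqrt t\<close>. The bound on \<open>y\<close> is exactly the positivity bound for
  \<open>r\<close>, with witness \<open>sqrt t\<close>.\<close>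

lemma norm_positive_sqrt:
  fixes a :: "'a::cstar_algebra"
  assumes "norm_positive a"
  obtains r where "norm_positive r" "r * r = a"
    "\<forall>z. z * a = a * z \<longrightarrow> z * r = r * z"
    "\<forall>C. unital_subalgebra C \<and> a \<in> C \<longrightarrow> r \<in> C"
proof -
  obtain t where a: "star a = a" and t: "t > 0" "norm (t *\<^sub>R 1 - a) \<le> t"
    using assms unfolding norm_positive_def by blast
  define c where "c = 1 - (1/t) *\<^sub>R a"
  have "star c = c" by (simp add: c_def star_diff star_scaleR a)
  moreover have "c = (1/t) *\<^sub>R (t *\<^sub>R 1 - a)" using t by (simp add: c_def algebra_simps)
  then have "norm c \<le> 1" using t by (simp add: divide_simps)
  ultimately obtain y where y: "star y = y" "norm y \<le> 1" "(1 - y) * (1 - y) = 1 - c"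
    "\<forall>z. z * c = c * z \<longrightarrow> z * y = y * z"
    "\<forall>C. unital_subalgebra C \<and> c \<in> C \<longrightarrow> y \<in> C"
    by (rule root_one_minus)
  define r where "r = sqrt t *\<^sub>R (1 - y)"
  have "r * r = t *\<^sub>R ((1 - y) * (1 - y))" using t by (simp add: r_def)
  then have eq: "r * r = a" using t by (simp add: y c_def)
  have "norm_positive r"
    unfolding norm_positive_def
  proof (intro conjI exI)
    show "star r = r" by (simp add: r_def star_scaleR star_diff y)
    show "sqrt t > 0" using t by simp
    have "sqrt t *\<^sub>R 1 - r = sqrt t *\<^sub>R y" by (simp add: r_def algebra_simps)
    then show "norm (sqrt t *\<^sub>R 1 - r) \<le> sqrt t" using t y by (simp add: mult_left_le)
  qed
  moreover note eq
  moreover have "z * r = r * z" if "z * a = a * z" for z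
    using y(4)[rule_format, of z] that by (simp add: c_def r_def algebra_simps)
  moreover have "r \<in> C" if "unital_subalgebra C" "a \<in> C" for C
    using y(5)[rule_format, of C] that by (auto simp: c_def r_def intro!: unital_subalgebra_simps)
  ultimately show ?thesis using that by blast
qed

corollary norm_positive_sqrt_commute:
  fixes a :: "'a::cstar_algebra"
  assumes "norm_positive a"
  obtains r where "norm_positive r" "r * r = a" "\<forall>z. z * a = a * z \<longrightarrow> z * r = r * z"
  by (rule norm_positive_sqrt[OF assms]) (rule that)

lemma norm_positive_self_adjoint: "norm_positive a \<Longrightarrow> star a = a"
  by (simp add: norm_positive_def)

text \<open>The radii \<open>t\<close> and \<open>s\<close> add up, by the triangle
  inequality.\<close>

lemma norm_positive_add:
  assumes "norm_positive a" "norm_positive b"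
  shows "norm_positive (a + b)"
proof -
  obtain t s where t: "star a = a" "t > 0" "norm (t *\<^sub>R 1 - a) \<le> t"
    and s: "star b = b" "s > 0" "norm (s *\<^sub>R 1 - b) \<le> s"
    using assms unfolding norm_positive_def by blast
  have "(t + s) *\<^sub>R 1 - (a + b) = (t *\<^sub>R 1 - a) + (s *\<^sub>R 1 - b)" by (simp add: algebra_simps)
  then have "norm ((t + s) *\<^sub>R 1 - (a + b)) \<le> t + s"
    using norm_triangle_mono[OF t(3) s(3)] by (simp only:)
  then show ?thesis unfolding norm_positive_def
    using t s by (intro conjI exI[of _ "t + s"]) (auto simp: star_add)
qed

lemma norm_positive_scaleR:
  assumes "norm_positive a" "r > 0"
  shows "norm_positive (r *\<^sub>R a)"
proof -
  obtain t where t: "star a = a" "t > 0" "norm (t *\<^sub>R 1 - a) \<le> t"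
    using assms unfolding norm_positive_def by blast
  have "(r * t) *\<^sub>R 1 - r *\<^sub>R a = r *\<^sub>R (t *\<^sub>R 1 - a)" by (simp add: algebra_simps)
  then have "norm ((r * t) *\<^sub>R 1 - r *\<^sub>R a) \<le> r * t" using t assms(2) by simp
  then show ?thesis unfolding norm_positive_def
    using t assms(2) by (intro conjI exI[of _ "r * t"]) (auto simp: star_scaleR)
qed

lemma norm_positive_diff_norm:
  assumes "star a = a" "norm a \<le> s" "s > 0"
  shows "norm_positive (s *\<^sub>R 1 - a)"
  unfolding norm_positive_def using assms
  by (intro conjI exI[of _ s]) (auto simp: star_diff star_scaleR)

text \<open>The element \<open>u = k + i d\<close> satisfies \<open>star u * u = s\<close>, so it
  behaves like \<open>sqrt s\<close> times a unitary. Its imaginary part \<open>d\<close> is half a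
  difference of two elements of norm \<open>norm u\<close>.\<close>

lemma norm_add_i_unitary:
  fixes k d :: "'a::cstar_algebra"
  assumes "star k = k" "star d = d" "k * d = d * k" "k * k + d * d = s *\<^sub>R 1" "s \<ge> 0"
  shows "(norm d)\<^sup>2 \<le> s"
proof -
  let ?u = "k + \<i> *\<^sub>C d" and ?w = "k - \<i> *\<^sub>C d"
  have st: "star ?u = ?w" by (simp add: star_add star_scaleC assms)
  have "star ?u * ?u = k * k + d * d"
    unfolding st using assms(3)
    by (simp add: algebra_simps mult_scaleC_left mult_scaleC_right scaleC_scaleC)
  then have u: "(norm ?u)\<^sup>2 \<le> s"
    using assms(4,5) mult_left_le[OF norm_one_le[where 'a='a] assms(5)] norm_star_mult[of ?u]
    by simp
  have w: "norm ?w = norm ?u" by (simp only: st[symmetric] norm_star)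
  have "?u - ?w = (2 * \<i>) *\<^sub>C d"
    by (simp only: mult_2 scaleC_add_left) simp
  then have "2 * norm d = norm (?u - ?w)" by (simp only: norm_scaleC norm_mult) simp
  then have "norm d \<le> norm ?u" using norm_triangle_ineq4[of ?u ?w] w by linarith
  then have "(norm d)\<^sup>2 \<le> (norm ?u)\<^sup>2" by (intro power_mono) simp_all
  then show ?thesis using u by linarith
qed

text \<open>After scaling to \<open>k\<close> of norm at most 1, the root \<open>1 - y\<close> of
  \<open>1 - k * k\<close> commutes with \<open>k\<close>, and the two squares add up to 1.
  Therefore \<open>1 - k * k\<close>, the square of \<open>1 - y\<close>, has norm at most
  1.\<close>

lemma norm_positive_square:
  fixes h :: "'a::cstar_algebra"
  assumes "star h = h"
  shows "norm_positive (h * h)"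
proof -
  \<comment> \<open>The summand 1 keeps the scale positive when \<open>h = 0\<close>.\<close>
  define s where "s = norm h + 1"
  define k where "k = (1/s) *\<^sub>R h"
  have s: "s > 0" by (simp add: s_def add_nonneg_pos)
  have k: "star k = k" "norm k \<le> 1" using s by (auto simp: k_def star_scaleR assms s_def)
  have "star (k * k) = k * k" by (simp add: star_mult k)
  moreover have "norm (k * k) \<le> 1"
    using norm_mult_ineq[of k k] mult_mono[OF k(2) k(2)] by simp
  ultimately obtain y where y: "star y = y" "(1 - y) * (1 - y) = 1 - k * k"
    "\<forall>z. z * (k * k) = k * k * z \<longrightarrow> z * y = y * z"
    by (rule root_one_minus) (rule that)
  have "k * y = y * k" by (rule y(3)[rule_format]) (simp add: mult.assoc)
  then have comm: "k * (1 - y) = (1 - y) * k" by (simp add: left_diff_distrib right_diff_distrib)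
  have sa: "star (1 - y) = 1 - y" by (simp add: star_diff y(1))
  have "k * k + (1 - y) * (1 - y) = 1 *\<^sub>R 1" by (simp only: y(2)) simp
  then have "(norm (1 - y))\<^sup>2 \<le> 1" by (rule norm_add_i_unitary[OF k(1) sa comm]) simp
  then have "norm (1 - k * k) \<le> 1"
    by (simp only: norm_square_self_adjoint[OF sa, symmetric] y(2))
  then have "norm_positive (k * k)"
    unfolding norm_positive_def using k by (intro conjI exI[of _ 1]) (auto simp: star_mult)
  then have "norm_positive ((s * s) *\<^sub>R (k * k))" using s by (intro norm_positive_scaleR) auto
  then show ?thesis using s by (simp add: k_def)
qed

lemma norm_positive_0 [simp]: "norm_positive 0"
  using norm_positive_square[of 0] by simp

lemma commuting_squares_eq_0:
  fixes r s :: "'a::cstar_algebra"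
  assumes "star r = r" "star s = s" "r * s = s * r" "r * r + s * s = 0"
  shows "s = 0"
  using norm_add_i_unitary[of r s 0] assms by simp

text \<open>The square roots of \<open>a\<close> and of \<open>- a\<close> commute, and their
  squares add up to 0.\<close>

lemma norm_positive_antisym:
  fixes a :: "'a::cstar_algebra"
  assumes "norm_positive a" "norm_positive (- a)"
  shows "a = 0"
proof -
  obtain r where r: "norm_positive r" "r * r = a" "\<forall>z. z * a = a * z \<longrightarrow> z * r = r * z"
    by (rule norm_positive_sqrt_commute[OF assms(1)])
  obtain s where s: "norm_positive s" "s * s = - a" "\<forall>z. z * (- a) = - a * z \<longrightarrow> z * s = s * z"
    by (rule norm_positive_sqrt_commute[OF assms(2)])
  have "r * s = s * r" by (rule s(3)[rule_format]) (simp add: r(2)[symmetric] mult.assoc)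
  then have "s = 0"
    using r(1,2) s(1,2)
    by (intro commuting_squares_eq_0[of r s]) (auto simp: norm_positive_self_adjoint)
  then show ?thesis using s(2) by simp
qed

text \<open>The roots of \<open>c\<close> and of \<open>s - c\<close> commute and their squares add
  up to \<open>s\<close>, so \<open>norm_add_i_unitary\<close> bounds the root of
  \<open>c\<close>.\<close>

lemma norm_le_of_norm_positive:
  fixes c :: "'a::cstar_algebra"
  assumes "norm_positive c" "norm_positive (s *\<^sub>R 1 - c)" "s \<ge> 0"
  shows "norm c \<le> s"
proof -
  obtain r where r: "norm_positive r" "r * r = c" "\<forall>z. z * c = c * z \<longrightarrow> z * r = r * z"
    by (rule norm_positive_sqrt_commute[OF assms(1)])
  obtain q where q: "norm_positive q" "q * q = s *\<^sub>R 1 - c"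
    "\<forall>z. z * (s *\<^sub>R 1 - c) = (s *\<^sub>R 1 - c) * z \<longrightarrow> z * q = q * z"
    by (rule norm_positive_sqrt_commute[OF assms(2)])
  have "c * r = r * c" by (simp add: r(2)[symmetric] mult.assoc)
  then have "r * q = q * r"
    by (intro q(3)[rule_format]) (simp add: left_diff_distrib right_diff_distrib)
  then have "(norm r)\<^sup>2 \<le> s"
    using r(1,2) q(1,2) assms(3)
    by (intro norm_add_i_unitary[of q]) (simp_all add: norm_positive_self_adjoint)
  then show ?thesis
    by (simp only: norm_square_self_adjoint[OF norm_positive_self_adjoint[OF r(1)], symmetric] r(2))
qed


text \<open>
  With \<open>d = 1 - x x\<^sup>*\<close> one has \<open>(1 - x\<^sup>* x)\<^sup>n = 1 - x\<^sup>* (1 + d + \<dots> + d\<^bsup>n-1\<^esup>) x\<close>, so the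
  powers of the self-adjoint element \<open>1 - x\<^sup>* x\<close> grow at most linearly.
\<close>

lemma norm_positive_swap_unit:
  fixes x :: "'a::cstar_algebra"
  assumes "norm (1 - x * star x) \<le> 1"
  shows "norm (1 - star x * x) \<le> 1"
proof (rule ccontr)
  let ?d = "1 - x * star x" and ?b = "1 - star x * x"
  let ?K = "(norm x)\<^sup>2"
  assume "\<not> norm ?b \<le> 1"
  then have gt: "norm ?b > 1" by simp
  define s where "s n = (\<Sum>j<n. ?d ^ j)" for n
  have s_Suc: "s (Suc n) = 1 + s n * ?d" for n
    unfolding s_def sum.lessThan_Suc_shift by (simp add: sum_distrib_right power_commutes)
  have pow: "?b ^ n = 1 - star x * s n * x" for n
  proof (induction n)
    case (Suc n)
    have "?b ^ Suc n = (1 - star x * s n * x) * ?b" by (simp only: power_Suc2 Suc)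
    also have "\<dots> = 1 - star x * s (Suc n) * x"
      unfolding s_Suc by (simp add: algebra_simps)
    finally show ?case .
  qed (simp add: s_def)
  have "norm (s n) \<le> n" for n
  proof -
    have "norm (?d ^ j) \<le> 1" for j
      using norm_power_le[of ?d j] power_le_one[OF norm_ge_zero assms, of j] by linarith
    then show ?thesis
      unfolding s_def using sum_norm_bound[of "{..<n}" "\<lambda>j. ?d ^ j" 1] by simp
  qed
  then have "norm (star x * s n * x) \<le> norm x * n * norm x" for n
    by (intro order_trans[OF norm_mult_ineq] mult_mono) auto
  then have "norm (star x * s n * x) \<le> n * ?K" for n
    by (simp add: power2_eq_square mult_ac)
  then have lin: "norm (?b ^ n) \<le> 1 + n * ?K" for n
    unfolding pow
    by (rule order_trans[OF norm_triangle_ineq4 add_mono[OF norm_one_le]])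
  have sa: "star (?b ^ n) = ?b ^ n" for n
    by (induction n) (simp_all add: star_mult star_diff star_star power_commutes)
  \<comment> \<open>For self-adjoint elements the C*-identity makes the norm exactly multiplicative
    under squaring. A norm above 1 thus forces exponential growth along \<open>2 ^ k\<close>,
    against the linear bound \<open>lin\<close>.\<close>
  have "norm (?b ^ (2 ^ k)) = norm ?b ^ (2 ^ k)" for k
  proof (induction k)
    case (Suc k)
    have "2 ^ Suc k = 2 ^ k + (2 ^ k :: nat)" by simp
    then have "?b ^ (2 ^ Suc k) = ?b ^ (2 ^ k) * ?b ^ (2 ^ k)" by (simp only: power_add)
    then have "norm (?b ^ (2 ^ Suc k)) = (norm (?b ^ (2 ^ k)))\<^sup>2"
      by (simp only: norm_square_self_adjoint[OF sa])
    then show ?case by (simp add: Suc power_mult[symmetric] mult.commute)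
  qed simp
  then have grow: "norm ?b ^ (2 ^ k) \<le> 1 + 2 ^ k * ?K" for k
    using lin[of "2 ^ k"] by simp
  \<comment> \<open>Multiplied by \<open>r ^ (2 ^ k)\<close>, the right side of \<open>grow\<close>
    tends to 0 while its left side stays 1.\<close>
  define r where "r = 1 / norm ?b"
  have r: "norm r < 1" "r > 0" using gt by (auto simp: r_def divide_less_eq)
  have "(\<lambda>n. r ^ n + of_nat n * r ^ n * ?K) \<longlonglongrightarrow> 0 + 0 * ?K"
    using r by (intro tendsto_intros powser_times_n_limit_0 LIMSEQ_power_zero)
  moreover have "filterlim (\<lambda>k. 2 ^ k :: nat) at_top sequentially"
    by (intro filterlim_subseq strict_monoI power_strict_increasing) auto
  ultimately have "(\<lambda>k. r ^ (2 ^ k) + of_nat (2 ^ k) * r ^ (2 ^ k) * ?K) \<longlonglongrightarrow> 0"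
    by (auto dest: filterlim_compose)
  then have "\<forall>\<^sub>F k in sequentially. r ^ (2 ^ k) + of_nat (2 ^ k) * r ^ (2 ^ k) * ?K < 1"
    by (rule order_tendstoD) simp
  then obtain k where "r ^ (2 ^ k) + of_nat (2 ^ k) * r ^ (2 ^ k) * ?K < 1"
    using eventually_happens trivial_limit_sequentially by blast
  then have "r ^ (2 ^ k) * (1 + 2 ^ k * ?K) < 1" by (simp add: algebra_simps)
  moreover have nz: "norm ?b \<noteq> 0" using gt by linarith
  have "r ^ (2 ^ k) * norm ?b ^ (2 ^ k) = 1"
    unfolding r_def power_mult_distrib[symmetric] using nz by (simp del: norm_eq_zero)
  ultimately show False
    using mult_left_mono[OF grow[of k], of "r ^ (2 ^ k)"] r by simp
qed

text \<open>Rescaling by \<open>1 / sqrt t\<close> reduces to radius 1. The result replaces the fact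
  that \<open>x * star x\<close> and \<open>star x * x\<close> have the same nonzero
  spectrum.\<close>

lemma norm_positive_swap:
  fixes x :: "'a::cstar_algebra"
  assumes "norm_positive (x * star x)"
  shows "norm_positive (star x * x)"
proof -
  obtain t where t: "t > 0" "norm (t *\<^sub>R 1 - x * star x) \<le> t"
    using assms unfolding norm_positive_def by blast
  define y where "y = (1 / sqrt t) *\<^sub>R x"
  have scaled: "1 - y * star y = (1/t) *\<^sub>R (t *\<^sub>R 1 - x * star x)"
    "1 - star y * y = (1/t) *\<^sub>R (t *\<^sub>R 1 - star x * x)"
    using t by (simp_all add: y_def star_scaleR scaleR_diff_right)
  then have "norm (1 - y * star y) \<le> 1" using t by simp
  then have "norm (1 - star y * y) \<le> 1" by (rule norm_positive_swap_unit)
  then have "norm (t *\<^sub>R 1 - star x * x) \<le> t" using t scaled by (simp add: divide_simps)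
  then show ?thesis unfolding norm_positive_def using t
    by (auto simp: star_mult star_star)
qed

text \<open>With \<open>y = u + i v\<close> split into self-adjoint parts,
  \<open>star y * y + y * star y\<close> is twice the sum of the squares of \<open>u\<close> and
  \<open>v\<close>. Hence \<open>y * star y\<close> is positive; swapping the factors makes
  \<open>star y * y\<close> positive as well as negative.\<close>

lemma norm_positive_star_mult_if_minus:
  fixes y :: "'a::cstar_algebra"
  assumes "norm_positive (- (star y * y))"
  shows "y = 0"
proof -
  define u where "u = (1/2) *\<^sub>R (y + star y)"
  define v where "v = (- \<i> / 2) *\<^sub>C (y - star y)"
  have sa: "star u = u" "star v = v"
    by (simp_all add: u_def v_def star_scaleR star_scaleC star_add star_diff star_star add.commute
        star_minus complex_vector.scale_right_diff_distrib)
  have "u + \<i> *\<^sub>C v = y" "u - \<i> *\<^sub>C v = star y"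
    by (simp_all add: u_def v_def scaleR_scaleC scaleC_scaleC scaleC_add_right
      complex_vector.scale_right_diff_distrib scaleC_add_left[symmetric])
  then have y: "y = u + \<i> *\<^sub>C v" "star y = u - \<i> *\<^sub>C v" by simp_all
  have "y * star y = 2 *\<^sub>R (u * u) + 2 *\<^sub>R (v * v) + - (star y * y)"
    unfolding y(2) unfolding y(1)
    by (simp add: algebra_simps mult_scaleC_left mult_scaleC_right scaleC_scaleC scaleR_2)
  then have "norm_positive (y * star y)"
    using assms by (simp only:) (intro norm_positive_add norm_positive_scaleR norm_positive_square sa, auto)
  then have "norm_positive (star y * y)" by (rule norm_positive_swap)
  then have "star y * y = 0" using assms by (rule norm_positive_antisym)
  then show ?thesis by (simp add: star_mult_eq_0_iff)
qed

text \<open>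
  With \<open>a = x\<^sup>* x\<close>, \<open>k = |a|\<close> and \<open>q = k - a\<close>, the element \<open>y = x q k\<^bsup>1/2\<^esup>\<close> satisfies
  \<open>y\<^sup>* y = a q\<^sup>2 k = - (q\<^sup>2 / 2)\<^sup>2\<close>; hence \<open>q = 0\<close> and \<open>a = |a|\<close>.
\<close>

lemma norm_positive_star_mult:
  fixes x :: "'a::cstar_algebra"
  shows "norm_positive (star x * x)"
proof -
  define a where "a = star x * x"
  have a: "star a = a" by (simp add: a_def star_mult star_star)
  obtain k where k: "norm_positive k" "k * k = a * a"
    "\<forall>z. z * (a * a) = (a * a) * z \<longrightarrow> z * k = k * z"
    by (rule norm_positive_sqrt_commute[OF norm_positive_square[OF a]])
  obtain m where m: "norm_positive m" "m * m = k" "\<forall>z. z * k = k * z \<longrightarrow> z * m = m * z"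
    by (rule norm_positive_sqrt_commute[OF k(1)])
  have ak: "a * k = k * a" by (rule k(3)[rule_format]) (simp add: mult.assoc)
  have am: "a * m = m * a" by (rule m(3)[rule_format]) (rule ak)
  have km: "k * m = m * k" by (rule m(3)[rule_format]) (rule HOL.refl)
  define q where "q = k - a"
  have q: "star q = q" by (simp add: q_def star_diff a norm_positive_self_adjoint[OF k(1)])
  have qm: "q * m = m * q" by (simp add: q_def algebra_simps am km)
  have aq: "a * q = q * a" by (simp add: q_def algebra_simps ak)
  \<comment> \<open>Both forms come from \<open>k * k = a * a\<close> and from \<open>a\<close> and
    \<open>k\<close> commuting.\<close>
  have qq: "q * q = - (2 *\<^sub>R (a * q))" "q * q = 2 *\<^sub>R (q * k)"
    by (simp_all add: q_def algebra_simps ak k(2) scaleR_2)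
  define h where "h = (1/2) *\<^sub>R (q * q)"
  have aqh: "a * q = - h" by (simp add: h_def qq(1))
  have qkh: "q * k = h" by (simp add: h_def qq(2))
  have h: "star h = h" by (simp add: h_def star_scaleR star_mult q)
  define y where "y = x * q * m"
  have "star y * y = (m * q) * a * (q * m)"
    by (simp add: y_def a_def star_mult q norm_positive_self_adjoint[OF m(1)] mult.assoc)
  also have "\<dots> = q * (m * a) * (q * m)" by (simp only: qm[symmetric] mult.assoc)
  also have "\<dots> = q * a * (m * q) * m" by (simp only: am[symmetric] mult.assoc)
  also have "\<dots> = (q * a) * q * (m * m)" by (simp only: qm[symmetric] mult.assoc)
  also have "\<dots> = (a * q) * (q * k)" by (simp only: aq[symmetric] m(2) mult.assoc)
  finally have "- (star y * y) = h * h" by (simp add: aqh qkh)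
  then have "y = 0" using norm_positive_square[OF h] by (intro norm_positive_star_mult_if_minus) simp
  with \<open>- (star y * y) = h * h\<close> have "h * h = 0" by simp
  then have "q * q = 0" using star_mult_eq_0_iff[of h] h by (simp add: h_def)
  then have "q = 0" using star_mult_eq_0_iff[of q] q by simp
  then show ?thesis using k(1) by (simp add: q_def a_def)
qed

lemma positive_element_iff: "positive_element a \<longleftrightarrow> norm_positive a"
  for a :: "'a::cstar_algebra"
proof
  assume "norm_positive a"
  then obtain r where "norm_positive r" "r * r = a" by (rule norm_positive_sqrt_commute)
  then show "positive_element a"
    unfolding positive_element_def by (metis norm_positive_self_adjoint)
qed (auto simp: positive_element_def norm_positive_star_mult)

section \<open>Sums of positive elements and invertibility of \<open>1 + p\<close>\<close>

lemma norm_positive_sum: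
  "(\<And>i. i \<in> I \<Longrightarrow> norm_positive (f i)) \<Longrightarrow> norm_positive (sum f I)"
  by (induction I rule: infinite_finite_induct) (auto intro: norm_positive_add)

text \<open>The negative of one summand is the sum of the others, hence positive.\<close>

lemma sum_star_mult_eq_0D:
  fixes f :: "'i \<Rightarrow> 'a::cstar_algebra"
  assumes "finite I" "(\<Sum>i\<in>I. star (f i) * f i) = 0" "i \<in> I"
  shows "f i = 0"
proof -
  have "- (star (f i) * f i) = (\<Sum>j\<in>I - {i}. star (f j) * f j)"
    using assms(2) by (simp add: sum.remove[OF assms(1,3)] add_eq_0_iff2)
  then have "norm_positive (- (star (f i) * f i))"
    by (simp add: norm_positive_sum norm_positive_star_mult)
  then show ?thesis by (rule norm_positive_star_mult_if_minus)
qed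

text \<open>The inverse is the fixed point of the contraction sending \<open>x\<close> to
  \<open>1 + c * x\<close>, in place of a Neumann series.\<close>

lemma one_minus_right_inverse:
  fixes c :: "'a::cstar_algebra"
  assumes "norm c < 1"
  obtains x where "(1 - c) * x = 1"
proof -
  have "\<exists>!x. 1 + c * x = x"
  proof (rule banach_fix_type[of "norm c"])
    show "\<forall>x y. dist (1 + c * x) (1 + c * y) \<le> norm c * dist x y"
      using norm_mult_ineq[of c] by (simp add: dist_norm flip: right_diff_distrib)
  qed (use assms in auto)
  then obtain x where "1 + c * x = x" by blast
  then show ?thesis by (intro that[of x]) (simp add: algebra_simps)
qed

text \<open>Up to the factor \<open>t + 1\<close>, the element \<open>1 + p\<close> is
  \<open>1 - c\<close> with norm of \<open>c\<close> at most \<open>t / (t + 1)\<close>. Since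
  \<open>1 - c\<close> is self-adjoint, its right inverse is also a left inverse.\<close>

lemma one_plus_norm_positive_inverse:
  fixes p :: "'a::cstar_algebra"
  assumes "norm_positive p"
  obtains f where "f * (1 + p) = 1" "(1 + p) * f = 1"
proof -
  obtain t where t: "star p = p" "t > 0" "norm (t *\<^sub>R 1 - p) \<le> t"
    using assms unfolding norm_positive_def by blast
  define c where "c = (1 / (t + 1)) *\<^sub>R (t *\<^sub>R 1 - p)"
  have c: "star c = c" by (simp add: c_def star_scaleR star_diff t)
  have "norm c < 1" using t by (simp add: c_def divide_simps)
  then obtain x where x: "(1 - c) * x = 1" by (rule one_minus_right_inverse)
  have x': "star x * (1 - c) = 1"
    using arg_cong[OF x, of star] by (simp add: star_mult star_diff c)
  have "star x = star x * ((1 - c) * x)" by (simp add: x)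
  also have "\<dots> = x" by (simp only: mult.assoc[symmetric] x' mult_1_left)
  finally have xx: "x * (1 - c) = 1" using x' by simp
  have "1 - c = (1 / (t + 1)) *\<^sub>R ((t + 1) *\<^sub>R 1 - (t *\<^sub>R 1 - p))"
    using t unfolding c_def by (simp only: scaleR_diff_right) simp
  then have "1 - c = (1 / (t + 1)) *\<^sub>R (1 + p)" by (simp add: algebra_simps)
  then show ?thesis
    using x xx by (intro that[of "(1 / (t + 1)) *\<^sub>R x"]) auto
qed

section \<open>Traces and orthonormal bases\<close>

lemma clinear_sum_scaleC:
  assumes "clinear f"
  shows "f (\<Sum>i\<in>I. c i *\<^sub>C x i) = (\<Sum>i\<in>I. c i *\<^sub>C f (x i))"
proof -
  interpret Vector_Spaces.linear scaleC scaleC f by (rule assms)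
  show ?thesis by (simp add: sum scale)
qed

text \<open>Schur triangularisation turns the trace into the sum of the roots of the characteristic
  polynomial, each of which is an eigenvalue.\<close>

lemma mat_trace_nonneg_Reals:
  assumes M: "(M :: complex mat) \<in> carrier_mat n n"
    and ev: "\<And>k. eigenvalue M k \<Longrightarrow> k \<in> \<real>\<^sub>\<ge>\<^sub>0"
  shows "(\<Sum>i<n. M $$ (i, i)) \<in> \<real>\<^sub>\<ge>\<^sub>0"
proof -
  obtain es where es: "char_poly M = (\<Prod>e\<leftarrow>es. [:- e, 1:])" "length es = n"
    using char_poly_factorized[OF M] by blast
  obtain U P Q where UPQ: "schur_decomposition M es = (U, P, Q)"
    by (cases "schur_decomposition M es") auto
  from schur_decomposition[OF M es(1) UPQ]
  have wit: "similar_mat_wit M U P Q" and diag: "diag_mat U = es" by auto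
  note w = similar_mat_witD2[OF M wit]
  have mult: "(A * B) $$ (i, j) = (\<Sum>k<n. A $$ (i, k) * B $$ (k, j))"
    if "A \<in> carrier_mat n n" "B \<in> carrier_mat n n" "i < n" "j < n" for A B :: "complex mat" and i j
    using that by (auto simp: scalar_prod_def atLeast0LessThan)
  have PU: "P * U \<in> carrier_mat n n" using w by simp
  have "(\<Sum>i<n. M $$ (i, i)) = (\<Sum>i<n. \<Sum>k<n. (P * U) $$ (i, k) * Q $$ (k, i))"
    unfolding w(3) by (intro sum.cong HOL.refl mult[OF PU w(7)]) simp_all
  also have "\<dots> = (\<Sum>k<n. \<Sum>i<n. Q $$ (k, i) * (P * U) $$ (i, k))"
    by (subst sum.swap) (simp add: mult.commute)
  also have "\<dots> = (\<Sum>k<n. (Q * (P * U)) $$ (k, k))"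
    by (intro sum.cong HOL.refl mult[OF w(7) PU, symmetric]) simp_all
  also have "Q * (P * U) = (Q * P) * U" using w(5,6,7) by (intro assoc_mult_mat[symmetric])
  also have "\<dots> = U" using w(5) by (simp add: w(2))
  also have "(\<Sum>k<n. U $$ (k, k)) = (\<Sum>k<n. es ! k)"
    using w(5) unfolding diag[symmetric] by (intro sum.cong) (auto simp: diag_mat_def)
  finally have tr: "(\<Sum>i<n. M $$ (i, i)) = (\<Sum>k<n. es ! k)" .
  have "es ! k \<in> \<real>\<^sub>\<ge>\<^sub>0" if "k < n" for k
  proof (rule ev)
    have "es ! k \<in> set es" using that es(2) by simp
    then have "poly (char_poly M) (es ! k) = 0"
      unfolding es(1) poly_prod_list by (auto simp: prod_list_zero_iff)
    then show "eigenvalue M (es ! k)" using eigenvalue_root_char_poly[OF M] by simp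
  qed
  then have "(\<Sum>k<m. es ! k) \<in> \<real>\<^sub>\<ge>\<^sub>0" if "m \<le> n" for m
    using that by (induction m) (auto intro: nonneg_Reals_add_I)
  then show ?thesis unfolding tr by blast
qed

locale finite_basis =
  fixes B :: "'a::complex_vector set"
  assumes finite: "finite B"
    and independent: "complex_vector.independent B"
    and span: "complex_vector.span B = UNIV"
begin

abbreviation coord :: "'a \<Rightarrow> 'a \<Rightarrow> complex" where
  "coord b x \<equiv> complex_vector.representation B x b"

lemma coord_add: "coord b (x + y) = coord b x + coord b y"
  by (simp add: complex_vector.representation_add independent span)

lemma coord_scaleC: "coord b (c *\<^sub>C x) = c * coord b x"
  by (simp add: complex_vector.representation_scale independent span)

lemma coord_sum: "coord b (sum f I) = (\<Sum>i\<in>I. coord b (f i))"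
  by (simp add: complex_vector.representation_sum independent span)

lemma coord_basis: "b \<in> B \<Longrightarrow> c \<in> B \<Longrightarrow> coord c b = (if c = b then 1 else 0)"
  by (simp add: complex_vector.representation_basis independent)

lemma sum_coord: "(\<Sum>b\<in>B. coord b x *\<^sub>C b) = x"
  by (rule complex_vector.sum_representation_eq) (simp_all add: independent span finite)

lemma coord_sum_scaleC:
  assumes "c \<in> B"
  shows "coord c (\<Sum>b\<in>B. k b *\<^sub>C b) = k c"
proof -
  have "coord c (\<Sum>b\<in>B. k b *\<^sub>C b) = (\<Sum>b\<in>B. if b = c then k b else 0)"
    unfolding coord_sum by (intro sum.cong) (auto simp: coord_scaleC coord_basis assms)
  then show ?thesis using assms by (simp add: finite)
qed

definition trace :: "('a \<Rightarrow> 'a) \<Rightarrow> complex" where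
  "trace f = (\<Sum>b\<in>B. coord b (f b))"

lemma trace_add: "trace (\<lambda>x. f x + g x) = trace f + trace g"
  by (simp add: trace_def coord_add sum.distrib)

lemma trace_scaleC: "trace (\<lambda>x. c *\<^sub>C f x) = c * trace f"
  by (simp add: trace_def coord_scaleC sum_distrib_left)

lemma trace_id: "trace (\<lambda>x. x) = of_nat (complex_vector.dim (UNIV :: 'a set))"
proof -
  have "complex_vector.dim (UNIV :: 'a set) = card B"
    using complex_vector.dim_span_eq_card_independent[OF independent] span by simp
  then show ?thesis by (simp add: trace_def coord_basis)
qed

lemma coord_linear:
  assumes "clinear f"
  shows "coord b (f x) = (\<Sum>c\<in>B. coord c x * coord b (f c))"
proof -
  have "f x = f (\<Sum>c\<in>B. coord c x *\<^sub>C c)" by (simp only: sum_coord)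
  also have "\<dots> = (\<Sum>c\<in>B. coord c x *\<^sub>C f c)"
    by (rule clinear_sum_scaleC[OF assms])
  finally show ?thesis by (simp only: coord_sum coord_scaleC)
qed

lemma trace_commute:
  assumes "clinear f" "clinear g"
  shows "trace (\<lambda>x. f (g x)) = trace (\<lambda>x. g (f x))"
proof -
  have "trace (\<lambda>x. f (g x)) = (\<Sum>b\<in>B. \<Sum>c\<in>B. coord c (g b) * coord b (f c))"
    unfolding trace_def by (rule sum.cong[OF HOL.refl]) (rule coord_linear[OF assms(1)])
  also have "\<dots> = (\<Sum>c\<in>B. \<Sum>b\<in>B. coord b (f c) * coord c (g b))"
    by (subst sum.swap) (simp add: mult.commute)
  also have "\<dots> = trace (\<lambda>x. g (f x))"
    unfolding trace_def
    by (rule sum.cong[OF HOL.refl]) (rule coord_linear[OF assms(2), symmetric])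
  finally show ?thesis .
qed

lemma trace_nonneg_Reals:
  assumes f: "clinear f" and ev: "\<And>k v. f v = k *\<^sub>C v \<Longrightarrow> v \<noteq> 0 \<Longrightarrow> k \<in> \<real>\<^sub>\<ge>\<^sub>0"
  shows "trace f \<in> \<real>\<^sub>\<ge>\<^sub>0"
proof -
  obtain bs where bs: "set bs = B" "distinct bs"
    using finite finite_distinct_list by blast
  define n where "n = length bs"
  have bij: "bij_betw (\<lambda>i. bs ! i) {..<n} B"
    using bij_betw_nth[OF bs(2) _ bs(1)[symmetric]] n_def by blast
  define M where "M = Matrix.mat n n (\<lambda>(i, j). coord (bs ! i) (f (bs ! j)))"
  have M: "M \<in> carrier_mat n n" by (simp add: M_def)
  have "trace f = (\<Sum>i<n. M $$ (i, i))"
    unfolding trace_def sum.reindex_bij_betw[OF bij, symmetric] by (simp add: M_def)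
  moreover have "(\<Sum>i<n. M $$ (i, i)) \<in> \<real>\<^sub>\<ge>\<^sub>0"
  proof (rule mat_trace_nonneg_Reals[OF M])
    fix k assume "eigenvalue M k"
    then obtain v where v: "v \<in> carrier_vec n" "v \<noteq> 0\<^sub>v n" "M *\<^sub>v v = k \<cdot>\<^sub>v v"
      using M unfolding eigenvalue_def eigenvector_def by auto
    have Mv: "(\<Sum>j<n. coord (bs ! i) (f (bs ! j)) * vec_index v j) = k * vec_index v i" if "i < n" for i
    proof -
      have "vec_index (M *\<^sub>v v) i = (\<Sum>j<n. coord (bs ! i) (f (bs ! j)) * vec_index v j)"
        using v(1) that by (auto simp: M_def scalar_prod_def atLeast0LessThan intro!: sum.cong)
      then show ?thesis unfolding v(3) using v(1) that by simp
    qed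
    \<comment> \<open>The inverse of the enumeration \<open>bs\<close> carries the coordinates of
      the matrix eigenvector \<open>v\<close> over to an eigenvector \<open>x\<close> of
      \<open>f\<close>.\<close>
    define idx where "idx b = the_inv_into {..<n} (\<lambda>i. bs ! i) b" for b
    have idx: "idx (bs ! i) = i" if "i < n" for i
      unfolding idx_def using bij that by (simp add: bij_betw_def the_inv_into_f_f)
    define x where "x = (\<Sum>b\<in>B. vec_index v (idx b) *\<^sub>C b)"
    have cx: "coord (bs ! i) x = vec_index v i" if "i < n" for i
      unfolding x_def using that idx bij by (subst coord_sum_scaleC) (auto simp: bij_betw_def)
    have "coord b (f x) = coord b (k *\<^sub>C x)" if "b \<in> B" for b
    proof -
      have "b \<in> (!) bs ` {..<n}" using bij that by (simp add: bij_betw_def)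
      then obtain i where i: "i < n" "b = bs ! i" by auto
      have "coord b (f x) = (\<Sum>j<n. coord (bs ! j) x * coord b (f (bs ! j)))"
        unfolding coord_linear[OF f, where b=b and x=x]
        by (rule sum.reindex_bij_betw[OF bij, symmetric])
      also have "\<dots> = k * vec_index v i"
        unfolding Mv[OF i(1), symmetric] using i by (intro sum.cong) (auto simp: cx)
      finally show ?thesis by (simp add: coord_scaleC i cx)
    qed
    then have "(\<Sum>b\<in>B. coord b (f x) *\<^sub>C b) = (\<Sum>b\<in>B. coord b (k *\<^sub>C x) *\<^sub>C b)"
      by (intro sum.cong) auto
    then have "f x = k *\<^sub>C x" by (simp only: sum_coord)
    moreover have "x \<noteq> 0"
    proof
      assume "x = 0"
      then have "vec_index v i = 0" if "i < n" for i
        using cx[OF that] coord_scaleC[where b="bs ! i" and c=0 and x=0] by simp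
      then show False using v(1,2) by (auto intro: eq_vecI)
    qed
    ultimately show "k \<in> \<real>\<^sub>\<ge>\<^sub>0" by (rule ev)
  qed
  ultimately show ?thesis by simp
qed

end

text \<open>Self-adjointness makes \<open>k\<close> real; if \<open>k\<close> were negative,
  \<open>- q\<close> would be a positive multiple of \<open>p\<close>. This serves to bound the
  eigenvalues of left multiplication by \<open>x * star x\<close>.\<close>

lemma scaleC_norm_positive_nonneg:
  fixes p q :: "'a::cstar_algebra"
  assumes "norm_positive p" "norm_positive q" "p = k *\<^sub>C q" "q \<noteq> 0"
  shows "k \<in> \<real>\<^sub>\<ge>\<^sub>0"
proof -
  have "k *\<^sub>C q = cnj k *\<^sub>C q"
    using norm_positive_self_adjoint[OF assms(1)]
    unfolding assms(3) star_scaleC norm_positive_self_adjoint[OF assms(2)] by (rule HOL.sym)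
  then have "k = cnj k" using assms(4) complex_vector.scale_cancel_right[of k q "cnj k"] by blast
  then obtain r where r: "k = of_real r" by (metis Reals_cases Reals_cnj_iff)
  have "r \<ge> 0"
  proof (rule ccontr)
    assume "\<not> r \<ge> 0"
    then have neg: "1 / - r > 0" "r \<noteq> 0" by auto
    have "(1 / - r) *\<^sub>R p = - q"
      using neg(2) by (simp add: assms(3) r scaleR_scaleC[symmetric])
    then have "norm_positive (- q)" using norm_positive_scaleR[OF assms(1) neg(1)] by simp
    then show False using norm_positive_antisym[OF assms(2)] assms(4) by blast
  qed
  then show ?thesis by (simp add: r)
qed

section \<open>Semidefinite sesquilinear forms and orthonormal bases\<close>

locale positive_form =
  fixes h :: "'a::complex_vector \<Rightarrow> 'a \<Rightarrow> complex"
  assumes add_left: "h (x + y) z = h x z + h y z"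
    and add_right: "h x (y + z) = h x y + h x z"
    and scaleC_left: "h (c *\<^sub>C x) y = c * h x y"
    and scaleC_right: "h x (c *\<^sub>C y) = cnj c * h x y"
    and nonneg: "h x x \<in> \<real>\<^sub>\<ge>\<^sub>0"
begin

text \<open>Polarisation: the form is real on \<open>x + y\<close> and on
  \<open>x + i y\<close>.\<close>

lemma commute: "h y x = cnj (h x y)"
proof -
  have im: "Im (h z z) = 0" for z using nonneg[of z] by (auto simp: complex_nonneg_Reals_iff)
  have "Im (h x y) + Im (h y x) = 0"
    using im[of "x + y"] im[of x] im[of y] by (simp add: add_left add_right)
  moreover have "Re (h y x) - Re (h x y) = 0"
    using im[of "x + \<i> *\<^sub>C y"] im[of x] im[of y]
    by (simp add: add_left add_right scaleC_left scaleC_right)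
  ultimately show ?thesis by (simp add: complex_eq_iff)
qed

text \<open>The degenerate case of the Cauchy-Schwarz inequality: if \<open>h x y\<close> were
  nonzero, adding a multiple of \<open>x\<close> to \<open>y\<close> could make the form
  negative.\<close>

lemma null_vector:
  assumes "h x x = 0"
  shows "h x y = 0"
proof (rule ccontr)
  assume c: "h x y \<noteq> 0"
  \<comment> \<open>Chosen so that the two cross terms together contribute
    \<open>- 2 * (Re (h y y) + 1)\<close>, which outweighs \<open>h y y\<close>.\<close>
  define t where "t = (Re (h y y) + 1) / (cmod (h x y))\<^sup>2"
  define s where "s = - of_real t * cnj (h x y)"
  have "h (s *\<^sub>C x + y) (s *\<^sub>C x + y) = s * h x y + cnj (s * h x y) + h y y"
    using commute[of y x] by (simp add: add_left add_right scaleC_left scaleC_right assms)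
  moreover have "s * h x y = - of_real (t * (cmod (h x y))\<^sup>2)"
    unfolding s_def of_real_mult complex_norm_square by (simp add: mult_ac)
  moreover have "t * (cmod (h x y))\<^sup>2 = Re (h y y) + 1" using c by (simp add: t_def)
  ultimately have "Re (h (s *\<^sub>C x + y) (s *\<^sub>C x + y)) = - Re (h y y) - 2" by simp
  moreover have "Re (h z z) \<ge> 0" for z using nonneg[of z] by (simp add: complex_nonneg_Reals_iff)
  ultimately show False by (smt (verit))
qed

lemma zero_left: "h 0 y = 0" using scaleC_left[of 0 0 y] by simp

lemma sum_left: "h (sum f I) y = (\<Sum>i\<in>I. h (f i) y)"
  by (induction I rule: infinite_finite_induct) (simp_all add: add_left zero_left)

lemma diff_left: "h (x - y) z = h x z - h y z"
  using add_left[of "x - y" y z] by simp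

definition orthonormal :: "'a set \<Rightarrow> bool" where
  "orthonormal G \<longleftrightarrow> finite G \<and> (\<forall>g\<in>G. \<forall>g'\<in>G. h g g' = (if g = g' then 1 else 0))"

lemma orthonormal_sum:
  assumes "orthonormal G" "g \<in> G"
  shows "h (\<Sum>g\<in>G. c g *\<^sub>C g) g = c g"
proof -
  have "h (\<Sum>g\<in>G. c g *\<^sub>C g) g = (\<Sum>g'\<in>G. if g' = g then c g' else 0)"
    unfolding sum_left using assms by (intro sum.cong) (auto simp: scaleC_left orthonormal_def)
  then show ?thesis using assms by (simp add: orthonormal_def)
qed

lemma orthonormal_independent:
  assumes "orthonormal G"
  shows "complex_vector.independent G"
proof -
  have fin: "finite G" using assms by (simp add: orthonormal_def)
  have "c g = 0" if "(\<Sum>g\<in>G. c g *\<^sub>C g) = 0" "g \<in> G" for c g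
    using orthonormal_sum[OF assms that(2), of c] that(1) zero_left by simp
  then show ?thesis unfolding complex_vector.dependent_finite[OF fin] by blast
qed

text \<open>Orthonormal sets are independent, so one of largest cardinality exists. If it missed
  some \<open>x\<close>, the normalised remainder of the projection of \<open>x\<close> would
  enlarge it.\<close>

lemma orthonormal_basis_exists:
  fixes B :: "'a set"
  assumes fin: "finite B" "complex_vector.span B = UNIV"
    and definite: "\<And>x. h x x = 0 \<Longrightarrow> x = 0"
  obtains G where "orthonormal G" "\<And>x. x = (\<Sum>g\<in>G. h x g *\<^sub>C g)"
proof -
  have "card G \<le> card B" if "orthonormal G" for G
    using complex_vector.independent_span_bound[OF fin(1) orthonormal_independent[OF that]] fin(2)
    by simp
  then have "\<forall>G. orthonormal G \<longrightarrow> card G < Suc (card B)" by (simp add: less_Suc_eq_le)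
  moreover have "orthonormal {}" by (simp add: orthonormal_def)
  ultimately obtain G where G: "orthonormal G" and max: "\<And>G'. orthonormal G' \<Longrightarrow> card G' \<le> card G"
    using ex_has_greatest_nat[of orthonormal "{}" card "Suc (card B)"] by blast
  have "x = (\<Sum>g\<in>G. h x g *\<^sub>C g)" for x
  proof (rule ccontr)
    assume ne: "x \<noteq> (\<Sum>g\<in>G. h x g *\<^sub>C g)"
    define y where "y = x - (\<Sum>g\<in>G. h x g *\<^sub>C g)"
    have yg: "h y g = 0" if "g \<in> G" for g
      unfolding y_def diff_left orthonormal_sum[OF G that] by simp
    have "h y y \<noteq> 0" using ne definite[of y] by (auto simp: y_def)
    then obtain r where r: "h y y = of_real r" "r > 0"
      using nonneg[of y] by (metis nonneg_Reals_cases of_real_0 less_eq_real_def)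
    define u where "u = (1 / of_real (sqrt r)) *\<^sub>C y"
    have "of_real (sqrt r) * of_real (sqrt r) = (of_real r :: complex)"
      using r(2) by (simp flip: of_real_mult)
    then have uu: "h u u = 1"
      using r(2) by (simp add: u_def scaleC_left scaleC_right r(1))
    have ug: "h u g = 0" "h g u = 0" if "g \<in> G" for g
      using yg[OF that] commute[of u g] by (simp_all add: u_def scaleC_left)
    then have "u \<notin> G" using uu by auto
    moreover have "orthonormal (insert u G)"
      using G uu ug \<open>u \<notin> G\<close> by (auto simp: orthonormal_def)
    ultimately show False using max[of "insert u G"] G by (simp add: orthonormal_def)
  qed
  with G show ?thesis by (rule that)
qed

end

section \<open>The coproduct of the distinguished projection\<close>

lemma clinear_add: "clinear f \<Longrightarrow> f (x + y) = f x + f y"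
  and clinear_scaleC: "clinear f \<Longrightarrow> f (c *\<^sub>C x) = c *\<^sub>C f x"
  by (simp_all add: clinear_iff)

lemma clinear_zero: "clinear f \<Longrightarrow> f 0 = 0"
  using clinear_add[of f 0 0] by simp

lemma clinear_sum: "clinear f \<Longrightarrow> f (sum g I) = (\<Sum>i\<in>I. f (g i))"
  by (induction I rule: infinite_finite_induct) (simp_all add: clinear_add clinear_zero)

lemma clinear_sum_list: "clinear f \<Longrightarrow> f (\<Sum>v\<leftarrow>vs. g v) = (\<Sum>v\<leftarrow>vs. f (g v))"
  by (induction vs) (simp_all add: clinear_add clinear_zero)

lemma tensor_zero_left [simp]: "0 \<otimes>\<^sub>C a = 0"
  using tensor_add_left[of 0 0 a] by simp

lemma clinear_tensor_lift_comp:
  assumes f: "cbilinear f" and F: "clinear F"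
  shows "F (tensor_lift f t) = tensor_lift (\<lambda>x y. F (f x y)) t"
proof -
  have Ff: "cbilinear (\<lambda>x y. F (f x y))"
    using f F by (simp add: cbilinear_iff clinear_iff)
  show ?thesis
    by (induction t)
      (simp_all add: tensor_lift_pure tensor_lift_add tensor_lift_zero f F Ff clinear_zero clinear_add)
qed

lemma cbilinear_pure_tensor:
  "clinear f \<Longrightarrow> clinear g \<Longrightarrow> cbilinear (\<lambda>x y. f x \<otimes>\<^sub>C g y)"
  by (simp add: cbilinear_iff clinear_iff tensor_add_left tensor_add_right tensor_scaleC_left
      tensor_scaleC_right)

lemma tensor_lift_tensor_map:
  assumes "clinear f" "clinear g" "cbilinear h"
  shows "tensor_lift h (tensor_map f g t) = tensor_lift (\<lambda>x y. h (f x) (g y)) t"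
  unfolding tensor_map_def
  by (simp add: clinear_tensor_lift_comp cbilinear_pure_tensor clinear_tensor_lift
      tensor_lift_pure assms)

lemma tensor_lift_zero_fun: "tensor_lift (\<lambda>x y. 0) t = 0"
proof -
  have "(\<Sum>(x, a)\<in>#s. 0) = 0" for s :: "('x \<times> 'y) multiset" by (induction s) auto
  then show ?thesis by (simp add: tensor_lift_def)
qed

lemma tensor_lift_sum_fun:
  "tensor_lift (\<lambda>x y. \<Sum>i\<in>I. f i x y) t = (\<Sum>i\<in>I. tensor_lift (f i) t)"
  by (induction I rule: infinite_finite_induct)
    (simp_all add: tensor_lift_zero_fun tensor_lift_add_fun)

lemma clinear_id: "clinear id" "clinear (\<lambda>x. x)"
  by (simp_all add: clinear_iff)

lemma cbilinear_mult: "cbilinear ((*) :: 'a::star_algebra \<Rightarrow> 'a \<Rightarrow> 'a)"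
  by (simp add: cbilinear_iff distrib_left distrib_right mult_scaleC_left mult_scaleC_right)

lemma cbilinear_compose: "cbilinear h \<Longrightarrow> clinear f \<Longrightarrow> clinear g \<Longrightarrow> cbilinear (\<lambda>x y. h (f x) (g y))"
  by (simp add: cbilinear_iff clinear_iff)

lemma clinear_mult_left: "clinear (\<lambda>x. a * x)" and clinear_mult_right: "clinear (\<lambda>x. x * a)"
  for a :: "'a::star_algebra"
  by (simp_all add: clinear_iff distrib_left distrib_right mult_scaleC_left mult_scaleC_right)

context hopf_star_algebra
begin

lemma Delta_linear: "clinear \<Delta>" and Delta_mult: "\<Delta> (a * b) = \<Delta> a * \<Delta> b"
  using Delta_hom by (simp_all add: star_hom_def)

lemma eps_linear: "clinear \<epsilon>"
  using eps_hom by (simp add: star_hom_def)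

lemma counit_left': "tensor_lift (\<lambda>x y. \<epsilon> x *\<^sub>C y) (\<Delta> a) = a"
  using counit_left[of a]
  by (subst (asm) tensor_lift_tensor_map)
    (simp_all add: eps_linear clinear_id cbilinear_iff scaleC_add_left scaleC_add_right
      scaleC_scaleC scaleC_complex_def mult.commute)

lemma counit_right': "tensor_lift (\<lambda>x y. \<epsilon> y *\<^sub>C x) (\<Delta> a) = a"
  using counit_right[of a]
  by (subst (asm) tensor_lift_tensor_map)
    (simp_all add: eps_linear clinear_id cbilinear_iff scaleC_add_left scaleC_add_right
      scaleC_scaleC scaleC_complex_def mult.commute)

lemma antipode_right': "tensor_lift (\<lambda>x y. x * S y) (\<Delta> a) = \<epsilon> a *\<^sub>C 1"
  using antipode_right[of a]
  by (subst (asm) tensor_lift_tensor_map) (simp_all add: S_linear clinear_id cbilinear_mult)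

lemma cbilinear_mult_S: "cbilinear (\<lambda>x y. x * S y)"
  by (rule cbilinear_compose[OF cbilinear_mult clinear_id(2) S_linear])

lemma cbilinear_Delta_mult: "cbilinear (\<lambda>x y. \<Delta> x * (1 \<otimes>\<^sub>C S y))"
  by (intro cbilinear_compose[OF cbilinear_mult] Delta_linear)
    (simp add: clinear_iff clinear_add[OF S_linear] clinear_scaleC[OF S_linear] tensor_add_right
      tensor_scaleC_right)

text \<open>In Sweedler notation: \<open>\<Delta> a\<^sub>1 (1 \<otimes> S a\<^sub>2) = a \<otimes> 1\<close>.\<close>

lemma Delta_antipode: "tensor_lift (\<lambda>x y. \<Delta> x * (1 \<otimes>\<^sub>C S y)) (\<Delta> a) = a \<otimes>\<^sub>C 1"
proof -
  \<comment> \<open>\<open>M\<close> multiplies after applying \<open>S\<close> to the second leg,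
    and \<open>F\<close> is the identity tensored with \<open>M\<close>. On one side of
    coassociativity \<open>F\<close> collapses to \<open>a \<otimes>\<^sub>C 1\<close> by the
    antipode and the counit; on the other side it yields the sum in question.\<close>
  define M where "M = tensor_lift (\<lambda>x y. x * S y)"
  have M: "clinear M" unfolding M_def by (rule clinear_tensor_lift[OF cbilinear_mult_S])
  define F where "F = tensor_lift (\<lambda>(x::'a) u. id x \<otimes>\<^sub>C M u)"
  have bF: "cbilinear (\<lambda>(x::'a) u. id x \<otimes>\<^sub>C M u)" by (rule cbilinear_pure_tensor[OF clinear_id(1) M])
  have F: "clinear F" unfolding F_def by (rule clinear_tensor_lift[OF bF])
  have F_pure: "F (x \<otimes>\<^sub>C u) = x \<otimes>\<^sub>C M u" for x u
    unfolding F_def tensor_lift_pure[OF bF] by simp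
  have M_pure: "M (x \<otimes>\<^sub>C y) = x * S y" for x y
    unfolding M_def by (rule tensor_lift_pure[OF cbilinear_mult_S])
  have "F (tensor_map id \<Delta> (\<Delta> a)) = tensor_lift (\<lambda>x y. x \<otimes>\<^sub>C M (\<Delta> y)) (\<Delta> a)"
    unfolding F_def tensor_lift_tensor_map[OF clinear_id(1) Delta_linear bF] by simp
  also have "\<dots> = tensor_lift (\<lambda>x y. (\<epsilon> y *\<^sub>C x) \<otimes>\<^sub>C 1) (\<Delta> a)"
    unfolding M_def antipode_right' by (simp add: tensor_scaleC_left tensor_scaleC_right)
  also have "\<dots> = tensor_lift (\<lambda>x y. \<epsilon> y *\<^sub>C x) (\<Delta> a) \<otimes>\<^sub>C 1"
    by (rule clinear_tensor_lift_comp[symmetric])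
      (simp_all add: clinear_iff cbilinear_iff tensor_add_left tensor_scaleC_left scaleC_add_right
        scaleC_add_left scaleC_scaleC clinear_add[OF eps_linear] clinear_scaleC[OF eps_linear]
        scaleC_complex_def mult.commute)
  finally have 1: "F (tensor_map id \<Delta> (\<Delta> a)) = a \<otimes>\<^sub>C 1" by (simp only: counit_right')
  have b1: "cbilinear (\<lambda>(p::'a) (q::'a). p \<otimes>\<^sub>C (q \<otimes>\<^sub>C z))" for z :: 'a
    by (simp add: cbilinear_iff tensor_add_left tensor_add_right tensor_scaleC_left
        tensor_scaleC_right)
  have b2: "cbilinear (\<lambda>u (z::'a). tensor_lift (\<lambda>(p::'a) (q::'a). p \<otimes>\<^sub>C (q \<otimes>\<^sub>C z)) u)"
    unfolding cbilinear_iff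
    by (simp add: tensor_lift_add tensor_lift_scaleC b1 tensor_add_right
        tensor_scaleC_right tensor_lift_add_fun tensor_lift_scaleC_fun)
  have *: "F (tensor_lift (\<lambda>p q. p \<otimes>\<^sub>C (q \<otimes>\<^sub>C z)) u) = u * (1 \<otimes>\<^sub>C S z)" for u z
    by (induction u)
      (simp_all add: tensor_lift_pure tensor_lift_add tensor_lift_zero b1 clinear_add[OF F]
        clinear_zero[OF F] distrib_right F_pure M_pure tensor_mult_pure)
  have "F (tensor_assoc (tensor_map \<Delta> id (\<Delta> a)))
    = tensor_lift (\<lambda>x z. F (tensor_lift (\<lambda>p q. p \<otimes>\<^sub>C (q \<otimes>\<^sub>C z)) (\<Delta> x))) (\<Delta> a)"
    unfolding tensor_assoc_def tensor_lift_tensor_map[OF Delta_linear clinear_id(1) b2]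
    unfolding id_def
    by (rule clinear_tensor_lift_comp[OF _ F]) (rule cbilinear_compose[OF b2 Delta_linear clinear_id(2)])
  then show ?thesis unfolding * coassoc 1 by (rule HOL.sym)
qed

end

locale hopf_projection = hopf_star_algebra \<Delta> \<epsilon> S
  for \<Delta> :: "'a::cstar_algebra \<Rightarrow> ('a, 'a) tensor" and \<epsilon> :: "'a \<Rightarrow> complex" and S :: "'a \<Rightarrow> 'a" +
  fixes e :: 'a
  assumes distinguished: "distinguished_projection \<epsilon> e"
begin

lemma e_idem: "e * e = e" and e_nonzero: "e \<noteq> 0" and e_absorb: "a * e = \<epsilon> a *\<^sub>C e"
  and e_absorb': "e * a = \<epsilon> a *\<^sub>C e"
  using distinguished
  unfolding distinguished_projection_def minimal_central_projection_def central_projection_def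
  by metis+

lemma eps_e: "\<epsilon> e = 1"
proof -
  have "\<epsilon> e *\<^sub>C e = 1 *\<^sub>C e" using e_absorb[of e] by (simp add: e_idem)
  then show ?thesis using e_nonzero complex_vector.scale_cancel_right by blast
qed

text \<open>Insert \<open>Delta_antipode\<close> for \<open>a \<otimes>\<^sub>C 1\<close>. Since
  \<open>e\<close> absorbs the first leg, \<open>\<Delta> e * \<Delta> x\<close> is
  \<open>\<epsilon> x\<close> times \<open>\<Delta> e\<close>, and the counit axiom recombines the
  legs of \<open>\<Delta> a\<close>.\<close>

lemma Delta_e_mult: "\<Delta> e * (a \<otimes>\<^sub>C 1) = \<Delta> e * (1 \<otimes>\<^sub>C S a)"
proof -
  have lin: "clinear (\<lambda>y. \<Delta> e * (1 \<otimes>\<^sub>C S y))"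
    by (simp add: clinear_iff clinear_add[OF S_linear] clinear_scaleC[OF S_linear] tensor_add_right
      tensor_scaleC_right distrib_left mult_scaleC_right)
  have *: "\<Delta> e * (\<Delta> x * (1 \<otimes>\<^sub>C S y)) = \<Delta> e * (1 \<otimes>\<^sub>C S (\<epsilon> x *\<^sub>C y))" for x y
  proof -
    have "\<Delta> e * (\<Delta> x * (1 \<otimes>\<^sub>C S y)) = \<Delta> (e * x) * (1 \<otimes>\<^sub>C S y)"
      by (simp add: Delta_mult mult.assoc)
    also have "\<dots> = \<epsilon> x *\<^sub>C (\<Delta> e * (1 \<otimes>\<^sub>C S y))"
      by (simp add: e_absorb' clinear_scaleC[OF Delta_linear] mult_scaleC_left)
    finally show ?thesis using clinear_scaleC[OF lin] by simp
  qed
  have "\<Delta> e * (a \<otimes>\<^sub>C 1) = tensor_lift (\<lambda>x y. \<Delta> e * (\<Delta> x * (1 \<otimes>\<^sub>C S y))) (\<Delta> a)"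
    unfolding Delta_antipode[of a, symmetric]
    by (rule clinear_tensor_lift_comp[OF cbilinear_Delta_mult clinear_mult_left])
  also have "\<dots> = \<Delta> e * (1 \<otimes>\<^sub>C S (tensor_lift (\<lambda>x y. \<epsilon> x *\<^sub>C y) (\<Delta> a)))"
    unfolding *
    by (rule clinear_tensor_lift_comp[OF _ lin, symmetric])
      (simp add: cbilinear_iff scaleC_add_right
        scaleC_add_left scaleC_scaleC clinear_add[OF eps_linear] clinear_scaleC[OF eps_linear]
        scaleC_complex_def mult.commute)
  finally show ?thesis by (simp only: counit_left')
qed

text \<open>This is \<open>Delta_e_mult\<close> at \<open>S a\<close> with \<open>S\<close> applied
  to the first leg: as \<open>S\<close> is an antimultiplicative involution, right multiplication of
  the second leg becomes left multiplication of the first.\<close>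

lemma tensor_lift_Delta_e:
  assumes f: "cbilinear f"
  shows "tensor_lift (\<lambda>x y. f (S x) (y * a)) (\<Delta> e) = tensor_lift (\<lambda>x y. f (a * S x) y) (\<Delta> e)"
proof -
  define F where "F = tensor_lift (\<lambda>x y. f (S x) y)"
  have b: "cbilinear (\<lambda>x y. f (S x) y)"
    by (rule cbilinear_compose[OF f S_linear clinear_id(2)])
  have b1: "cbilinear (\<lambda>x y. f (S x) (y * c))" "cbilinear (\<lambda>x y. f (c * S x) y)" for c
    by (intro cbilinear_compose[OF f] S_linear clinear_mult_right clinear_id
      cbilinear_compose[OF cbilinear_compose[OF f clinear_mult_left clinear_id(2)] S_linear])+
  note s = tensor_lift_pure tensor_lift_add tensor_lift_zero distrib_right F_def tensor_mult_pure
    S_antimult S_S b b1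
  have "F (u * (S a \<otimes>\<^sub>C 1)) = tensor_lift (\<lambda>x y. f (a * S x) y) u" for u
    by (induction u) (simp_all add: s)
  moreover have "F (u * (1 \<otimes>\<^sub>C S (S a))) = tensor_lift (\<lambda>x y. f (S x) (y * a)) u" for u
    by (induction u) (simp_all add: s)
  ultimately show ?thesis using Delta_e_mult[of "S a"] by metis
qed

text \<open>Applying \<open>S\<close> to the antipode identity at \<open>e\<close> reverses the
  factors.\<close>

lemma tensor_lift_Delta_e_opposite: "tensor_lift (\<lambda>x y. y * S x) (\<Delta> e) = 1"
proof -
  have "S (tensor_lift (\<lambda>x y. x * S y) (\<Delta> e)) = tensor_lift (\<lambda>x y. S (x * S y)) (\<Delta> e)"
    by (rule clinear_tensor_lift_comp[OF cbilinear_mult_S S_linear])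
  then show ?thesis
    by (simp add: antipode_right' S_antimult S_S eps_e S_one scaleC_one)
qed

text \<open>
  The trace of the left regular representation has \<open>S(e\<^sub>1) \<otimes> e\<^sub>2\<close> as its dual tensor, so
  expanding in an orthonormal basis for it diagonalises \<open>\<Delta> e\<close>.
\<close>

lemma orthonormal_expansion:
  obtains G :: "'a set" and \<tau> :: "'a \<Rightarrow> complex" where
    "finite G" "clinear \<tau>" "\<And>x y. \<tau> (x * y) = \<tau> (y * x)"
    "\<tau> 1 = of_nat (complex_vector.dim (UNIV :: 'a set))"
    "\<And>g h. g \<in> G \<Longrightarrow> h \<in> G \<Longrightarrow> \<tau> (g * star h) = (if g = h then 1 else 0)"
    "\<And>x. x = (\<Sum>g\<in>G. \<tau> (x * star g) *\<^sub>C g)"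
    "\<Delta> e = (\<Sum>g\<in>G. S (star g) \<otimes>\<^sub>C g)"
proof -
  obtain B0 :: "'a set" where B0: "finite B0" "complex_vector.span B0 = UNIV"
    using finite_dim by blast
  obtain B where B: "B \<subseteq> B0" "complex_vector.independent B" "B0 \<subseteq> complex_vector.span B"
    using complex_vector.maximal_independent_subset by metis
  interpret finite_basis B
  proof
    show "finite B" using B(1) B0(1) by (rule finite_subset)
    show "complex_vector.independent B" by (rule B(2))
    show "complex_vector.span B = UNIV"
      using complex_vector.span_mono[OF B(3)] B0(2) by (auto simp: complex_vector.span_span)
  qed
  define \<tau> where "\<tau> a = trace (\<lambda>x. a * x)" for a
  have \<tau>: "clinear \<tau>"
    by (simp add: \<tau>_def clinear_iff distrib_right trace_add mult_scaleC_left trace_scaleC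
        scaleC_complex_def)
  have \<tau>_comm: "\<tau> (x * y) = \<tau> (y * x)" for x y
    unfolding \<tau>_def mult.assoc by (rule trace_commute) (rule clinear_mult_left)+
  have cb: "cbilinear (\<lambda>p q. \<phi> q *\<^sub>C p)" if "clinear \<phi>" for \<phi> :: "'a \<Rightarrow> complex"
    using that by (simp add: cbilinear_iff clinear_iff scaleC_add_left scaleC_add_right
      scaleC_scaleC scaleC_complex_def mult.commute)
  have coord: "clinear (coord b)" for b
    by (simp add: clinear_iff coord_add coord_scaleC scaleC_complex_def)
  \<comment> \<open>As a trace, \<open>\<tau> q\<close> is the sum of the coordinates of
    \<open>q * b\<close> at \<open>b\<close>. Each \<open>b\<close> moves to the other leg by
    \<open>tensor_lift_Delta_e\<close>, and the sum over \<open>B\<close> reassembles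
    \<open>q\<close>.\<close>
  have one: "tensor_lift (\<lambda>p q. \<tau> q *\<^sub>C S p) (\<Delta> e) = 1"
  proof -
    have "tensor_lift (\<lambda>p q. \<tau> q *\<^sub>C S p) (\<Delta> e)
      = (\<Sum>b\<in>B. tensor_lift (\<lambda>p q. coord b (q * b) *\<^sub>C S p) (\<Delta> e))"
      by (simp add: \<tau>_def trace_def complex_vector.scale_sum_left tensor_lift_sum_fun)
    also have "\<dots> = (\<Sum>b\<in>B. tensor_lift (\<lambda>p q. coord b q *\<^sub>C (b * S p)) (\<Delta> e))"
      by (rule sum.cong[OF HOL.refl], rule tensor_lift_Delta_e) (rule cb[OF coord])
    also have "\<dots> = tensor_lift (\<lambda>p q. (\<Sum>b\<in>B. coord b q *\<^sub>C b) * S p) (\<Delta> e)"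
      by (simp add: tensor_lift_sum_fun sum_distrib_right mult_scaleC_left)
    finally show ?thesis by (simp only: sum_coord tensor_lift_Delta_e_opposite)
  qed
  have dual: "tensor_lift (\<lambda>p q. \<tau> (q * x) *\<^sub>C S p) (\<Delta> e) = x" for x
  proof -
    have "tensor_lift (\<lambda>p q. \<tau> (q * x) *\<^sub>C S p) (\<Delta> e)
      = tensor_lift (\<lambda>p q. x * (\<tau> q *\<^sub>C S p)) (\<Delta> e)"
      unfolding mult_scaleC_right by (rule tensor_lift_Delta_e) (rule cb[OF \<tau>])
    also have "\<dots> = x * tensor_lift (\<lambda>p q. \<tau> q *\<^sub>C S p) (\<Delta> e)"
      by (rule clinear_tensor_lift_comp[OF _ clinear_mult_left, symmetric])
        (rule cbilinear_compose[OF cb[OF \<tau>] S_linear clinear_id(2)])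
    finally show ?thesis by (simp add: one)
  qed
  interpret form: positive_form "\<lambda>x y. \<tau> (x * star y)"
  proof
    fix x :: 'a
    \<comment> \<open>Positivity of the form: multiplying the eigenvalue equation by
      \<open>star v\<close> compares two positive elements, so all eigenvalues of left
      multiplication by \<open>x * star x\<close> are nonnegative.\<close>
    have "k \<in> \<real>\<^sub>\<ge>\<^sub>0" if v: "(x * star x) * v = k *\<^sub>C v" "v \<noteq> 0" for k v
    proof (rule scaleC_norm_positive_nonneg)
      show "star (star x * v) * (star x * v) = k *\<^sub>C (star v * v)"
        using arg_cong[OF v(1), of "\<lambda>z. star v * z"]
        by (simp add: star_mult star_star mult.assoc mult_scaleC_right)
      show "star v * v \<noteq> 0" using v(2) by (simp add: star_mult_eq_0_iff)
    qed (rule norm_positive_star_mult)+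
    then show "\<tau> (x * star x) \<in> \<real>\<^sub>\<ge>\<^sub>0"
      unfolding \<tau>_def by (intro trace_nonneg_Reals clinear_mult_left)
  qed (simp_all add: star_add star_scaleC distrib_left distrib_right mult_scaleC_left
      mult_scaleC_right clinear_add[OF \<tau>] clinear_scaleC[OF \<tau>] scaleC_complex_def)
  \<comment> \<open>A null vector pairs to zero with everything, and \<open>dual\<close> recovers
    \<open>x\<close> from these pairings.\<close>
  have definite: "x = 0" if "\<tau> (x * star x) = 0" for x
  proof -
    have "\<tau> (q * x) = 0" for q
      using form.null_vector[OF that, of "star q"] by (simp add: star_star \<tau>_comm)
    then show ?thesis using dual[of x] by (simp add: tensor_lift_zero_fun)
  qed
  obtain G where G: "form.orthonormal G" "\<And>x. x = (\<Sum>g\<in>G. \<tau> (x * star g) *\<^sub>C g)"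
    using form.orthonormal_basis_exists[OF B0 definite] by blast
  \<comment> \<open>The coefficient in the first factor that belongs to \<open>g\<close> when the
    second factor is expanded in \<open>G\<close>.\<close>
  define u where "u t g = tensor_lift (\<lambda>p q. \<tau> (q * star g) *\<^sub>C p) t" for t :: "('a, 'a) tensor" and g
  have cbu: "cbilinear (\<lambda>(p::'a) q. \<tau> (q * star g) *\<^sub>C p)" for g
    by (rule cbilinear_compose[OF cb[OF \<tau>] clinear_id(2) clinear_mult_right])
  have expand: "t = (\<Sum>g\<in>G. u t g \<otimes>\<^sub>C g)" for t
  proof (induction t)
    case (pure x a)
    have "x \<otimes>\<^sub>C a = x \<otimes>\<^sub>C (\<Sum>g\<in>G. \<tau> (a * star g) *\<^sub>C g)" using G(2)[of a] by simp
    also have "\<dots> = (\<Sum>g\<in>G. x \<otimes>\<^sub>C (\<tau> (a * star g) *\<^sub>C g))"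
      by (rule clinear_sum) (simp add: clinear_iff tensor_add_right tensor_scaleC_right)
    also have "\<dots> = (\<Sum>g\<in>G. u (x \<otimes>\<^sub>C a) g \<otimes>\<^sub>C g)"
      unfolding u_def tensor_lift_pure[OF cbu] by (simp only: tensor_scaleC_left tensor_scaleC_right)
    finally show ?case .
  qed (simp_all add: u_def tensor_lift_zero tensor_lift_add cbu tensor_add_left sum.distrib
      tensor_zero_left)
  have coeff: "u (\<Delta> e) g = S (star g)" for g
  proof -
    have "S (u (\<Delta> e) g) = tensor_lift (\<lambda>p q. \<tau> (q * star g) *\<^sub>C S p) (\<Delta> e)"
      unfolding u_def by (simp add: clinear_tensor_lift_comp[OF cbu S_linear] clinear_scaleC[OF S_linear])
    then show ?thesis using S_S dual by metis
  qed
  have De: "\<Delta> e = (\<Sum>g\<in>G. S (star g) \<otimes>\<^sub>C g)"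
    using expand[of "\<Delta> e"] by (simp only: coeff)
  have dim: "\<tau> 1 = of_nat (complex_vector.dim (UNIV :: 'a set))"
    by (simp add: \<tau>_def trace_id)
  have fin: "finite G" using G(1) unfolding form.orthonormal_def by (rule conjunct1)
  have orth: "\<tau> (g * star h) = (if g = h then 1 else 0)" if "g \<in> G" "h \<in> G" for g h
    using G(1) that unfolding form.orthonormal_def by simp
  show ?thesis by (rule that[OF fin \<tau> \<tau>_comm dim orth G(2) De])
qed

end

section \<open>Quasi-bases of conditional expectations\<close>

locale conditional_expectation =
  fixes E :: "'b::cstar_algebra \<Rightarrow> 'b" and C :: "'b set"
  assumes faithful_ce: "faithful_conditional_expectation E C"
begin

lemma subalgebra: "unital_subalgebra C"
  using faithful_ce by (simp add: unital_subalgebra_def faithful_conditional_expectation_def)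

lemmas C_simps = unital_subalgebra_simps[OF subalgebra]

lemma E_linear: "clinear E" and E_mem: "E x \<in> C" and E_ident: "c \<in> C \<Longrightarrow> E c = c"
  and E_bimodule: "c \<in> C \<Longrightarrow> d \<in> C \<Longrightarrow> E (c * x * d) = c * E x * d"
  and E_faithful: "E (star x * x) = 0 \<Longrightarrow> x = 0"
  and E_positive: "norm_positive (E (star x * x))"
  using faithful_ce
  unfolding faithful_conditional_expectation_def positive_element_iff by blast+

lemma E_left: "c \<in> C \<Longrightarrow> E (c * x) = c * E x" and E_right: "c \<in> C \<Longrightarrow> E (x * c) = E x * c"
  using E_bimodule[of c 1 x] E_bimodule[of 1 c x] C_simps(1) by simp_all

lemma E_add: "E (x + y) = E x + E y"
  and E_scaleC: "E (k *\<^sub>C x) = k *\<^sub>C E x"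
  using E_linear by (simp_all add: clinear_iff)

lemma E_diff: "E (x - y) = E x - E y"
  using E_add[of "x - y" y] by simp

lemma E_zero: "E 0 = 0"
  using E_add[of 0 0] by simp

lemma E_minus: "E (- x) = - E x"
  using E_diff[of 0 x] by (simp add: E_zero)

text \<open>A positive map is hermitian, by polarisation.\<close>

lemma E_star: "E (star x) = star (E x)"
proof -
  have sa: "star (E (star z * z)) = E (star z * z)" for z
    by (rule norm_positive_self_adjoint[OF E_positive])
  have E1: "E 1 = 1" by (rule E_ident[OF C_simps(1)])
  have sum: "star (E z) + star (E (star z)) = E z + E (star z)" for z
  proof -
    have "star (z + 1) * (z + 1) = star z * z + (z + star z) + 1"
      by (simp add: star_add distrib_left distrib_right add_ac)
    then have eq: "E (star (z + 1) * (z + 1)) = E (star z * z) + (E z + E (star z)) + 1"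
      by (simp only: E_add E1)
    have "star (E (star z * z) + (E z + E (star z)) + 1)
      = E (star z * z) + (E z + E (star z)) + 1"
      using sa[of "z + 1"] by (simp only: eq)
    then have "E (star z * z) + (star (E z) + star (E (star z))) + 1
      = E (star z * z) + (E z + E (star z)) + 1"
      by (simp only: star_add sa star_one)
    then show ?thesis by (simp only: add_left_cancel add_right_cancel)
  qed
  have "star (E (\<i> *\<^sub>C x)) + star (E (star (\<i> *\<^sub>C x))) = \<i> *\<^sub>C (star (E (star x)) - star (E x))"
    by (simp add: star_scaleC E_scaleC E_minus star_minus complex_vector.scale_right_diff_distrib)
  moreover have "E (\<i> *\<^sub>C x) + E (star (\<i> *\<^sub>C x)) = \<i> *\<^sub>C (E x - E (star x))"
    by (simp add: star_scaleC E_scaleC E_minus complex_vector.scale_right_diff_distrib)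
  ultimately have "\<i> *\<^sub>C (star (E (star x)) - star (E x)) = \<i> *\<^sub>C (E x - E (star x))"
    using sum[of "\<i> *\<^sub>C x"] by (simp only:)
  then have "star (E (star x)) - star (E x) = E x - E (star x)"
    by (rule complex_vector.scale_left_imp_eq[rotated]) simp
  then have "(star (E x) + star (E (star x))) - (star (E (star x)) - star (E x))
    = (E x + E (star x)) - (E x - E (star x))"
    by (simp only: sum)
  then have "2 *\<^sub>R E (star x) = 2 *\<^sub>R star (E x)" by (simp add: scaleR_2)
  then show ?thesis by simp
qed

text \<open>By faithfulness, the \<open>C\<close>-valued inner product \<open>E (star c * x)\<close>
  is nondegenerate.\<close>

lemma E_eqI:
  assumes "\<And>c. E (star c * x) = E (star c * y)"
  shows "x = y"
proof -
  have "E (star (x - y) * (x - y)) = 0"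
    using assms[of "x - y"] by (simp add: right_diff_distrib E_diff)
  then have "x - y = 0" by (rule E_faithful)
  then show ?thesis by simp
qed

text \<open>
  The operator \<open>b \<mapsto> b + w E(w\<^sup>* b)\<close> is positive and invertible on the right module \<open>B\<close> over \<open>C\<close>;
  its inverse square root is \<open>b \<mapsto> b + w f E(w\<^sup>* b)\<close> with \<open>f = - (u\<^sup>2 + u)\<^sup>-\<^sup>1\<close>, where
  \<open>u\<^sup>2 = 1 + E(w\<^sup>* w)\<close>.
\<close>

lemma rank_one_inverse_sqrt:
  obtains F where
    "clinear F" "\<forall>b c. c \<in> C \<longrightarrow> F (b * c) = F b * c"
    "\<forall>a b. E (star (F a) * b) = E (star a * F b)"
    "\<forall>b. F (F b + w * E (star w * F b)) = b"
proof -
  define h where "h = E (star w * w)"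
  have hpos: "norm_positive h" unfolding h_def by (rule E_positive)
  have hC: "h \<in> C" unfolding h_def by (rule E_mem)
  have "norm_positive (1 + h)"
    using norm_positive_add[OF norm_positive_square[of 1] hpos] by simp
  then obtain u where u: "norm_positive u" "u * u = 1 + h"
    "\<forall>C. unital_subalgebra C \<and> 1 + h \<in> C \<longrightarrow> u \<in> C"
    by (rule norm_positive_sqrt) (rule that)
  have uC: "u \<in> C" using u(3) subalgebra C_simps(1,4) hC by blast
  \<comment> \<open>Since \<open>u * u = 1 + h\<close>, the element \<open>1 + (h + u)\<close>
    equals \<open>u * u + u\<close>; it is invertible because \<open>h + u\<close> is
    positive.\<close>
  obtain f' where f': "f' * (1 + (h + u)) = 1" "(1 + (h + u)) * f' = 1"
    by (rule one_plus_norm_positive_inverse[OF norm_positive_add[OF hpos u(1)]])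
  define n where "n = u * u + u"
  have n: "1 + (h + u) = n" by (simp add: n_def u(2))
  define f where "f = - f'"
  have fn: "f * n = - 1" "n * f = - 1" using f' unfolding n by (simp_all add: f_def)
  have nC: "n \<in> C" by (simp add: n_def C_simps uC)
  have nsa: "star n = n" by (simp add: n_def star_add star_mult norm_positive_self_adjoint[OF u(1)])
  have left_inv: "y = f" if "y * n = - 1" for y
  proof -
    have "y * (n * f) = (y * n) * f" by (simp only: mult.assoc)
    then show ?thesis by (simp add: fn that)
  qed
  \<comment> \<open>\<open>E f\<close> solves the same equation \<open>y * n = - 1\<close> as
    \<open>f\<close>, so it coincides with \<open>f\<close>.\<close>
  have fC: "f \<in> C"
  proof -
    have "E f * n = E (f * n)" by (simp add: E_right nC)
    also have "\<dots> = - 1" by (simp only: fn) (intro E_ident C_simps)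
    finally show ?thesis using left_inv E_mem by metis
  qed
  have fsa: "star f = f"
    using arg_cong[OF fn(2), of star] by (intro left_inv) (simp add: star_mult nsa star_minus)
  have uf: "u * f = f * u"
  proof -
    have "u * n = n * u" by (simp add: n_def distrib_left distrib_right mult.assoc)
    then have "f * (u * n) * f = f * (n * u) * f" by simp
    then have "f * u * (n * f) = (f * n) * u * f" by (simp only: mult.assoc)
    then show ?thesis by (simp add: fn)
  qed
  define p where "p = f * u"
  have fuu: "f * u * u = - 1 - p"
    using fn(1) by (simp add: n_def p_def distrib_left mult.assoc eq_diff_eq)
  \<comment> \<open>With \<open>k = E (star w * b)\<close>, the middle expression
    \<open>F b + w * E (star w * F b)\<close> equals \<open>b + w * (m * k)\<close>. The identity
    \<open>key\<close> then says that one more application of \<open>F\<close> returns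
    \<open>b\<close>.\<close>
  define m where "m = f + 1 + h * f"
  have hf: "h = u * u - 1" by (simp add: u(2))
  have "u * u * f = f * u * u" by (metis uf mult.assoc)
  then have m: "m = - p"
    unfolding m_def hf by (simp add: left_diff_distrib fuu)
  have "f * h = - 1 - p - f"
    by (simp add: hf right_diff_distrib fuu mult.assoc[symmetric])
  then have "m + f + f * h * m = f + (p * p + f * p)"
    unfolding m by (simp add: left_diff_distrib right_diff_distrib)
  also have "p * p + f * p = f * (n * f)"
    by (simp add: p_def n_def distrib_left distrib_right mult.assoc uf)
  finally have key: "m + f + f * h * m = 0" by (simp add: fn)
  have mC: "m \<in> C" by (simp add: m_def C_simps fC hC)
  define F where "F b = b + w * (f * E (star w * b))" for b
  show ?thesis
  proof (rule that[of F]; (intro allI impI)?)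
    show "clinear F"
      by (simp add: clinear_iff F_def E_add E_scaleC distrib_left mult_scaleC_right scaleC_add_right)
    show "F (b * c) = F b * c" if "c \<in> C" for b c
      using E_right[OF that, of "star w * b"] by (simp add: F_def distrib_right mult.assoc)
    show "E (star (F a) * b) = E (star a * F b)" for a b
    proof -
      have "star (F a) * b = star a * b + (E (star a * w) * f) * (star w * b)"
        using E_star[of "star w * a"]
        by (simp add: F_def star_add star_mult star_star fsa distrib_right mult.assoc)
      then have "E (star (F a) * b) = E (star a * b) + (E (star a * w) * f) * E (star w * b)"
        by (simp add: E_add E_left C_simps E_mem fC)
      moreover have "star a * F b = star a * b + (star a * w) * (f * E (star w * b))"
        by (simp add: F_def distrib_left mult.assoc)
      then have "E (star a * F b) = E (star a * b) + E (star a * w) * (f * E (star w * b))"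
        by (simp only: E_add E_right[OF C_simps(6)[OF fC E_mem]])
      ultimately show ?thesis by (simp add: mult.assoc)
    qed
    show "F (F b + w * E (star w * F b)) = b" for b
    proof -
      define k where "k = E (star w * b)"
      have E_w: "E (star w * (b + w * (c * k))) = k + h * c * k" if "c \<in> C" for c
      proof -
        have "star w * (b + w * (c * k)) = star w * b + (star w * w) * (c * k)"
          by (simp add: distrib_left mult.assoc)
        moreover have "c * k \<in> C" by (simp add: C_simps that k_def E_mem)
        ultimately show ?thesis
          by (simp only: E_add E_right[of "c * k"] h_def[symmetric] k_def[symmetric] mult.assoc[of h])
      qed
      have Fb: "F b = b + w * (f * k)" by (simp add: F_def k_def)
      have "F b + w * E (star w * F b) = b + w * (m * k)"
        unfolding Fb E_w[OF fC] by (simp add: m_def distrib_left distrib_right mult.assoc add_ac)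
      then have "F (F b + w * E (star w * F b)) = b + w * (m * k) + w * (f * (k + h * m * k))"
        by (simp only: F_def E_w[OF mC])
      also have "\<dots> = b + w * ((m + f + f * h * m) * k)"
        by (simp add: distrib_left distrib_right mult.assoc add_ac)
      finally show ?thesis by (simp add: key)
    qed
  qed
qed

text \<open>Apply the hypothesis at \<open>F b\<close>, then apply \<open>F\<close>, where
  \<open>F\<close> is the inverse square root attached to one \<open>w\<close>. As \<open>F\<close>
  is symmetric and \<open>C\<close>-linear, each remaining term keeps its form with \<open>v\<close>
  replaced by \<open>F v\<close>, while the identity together with the term of \<open>w\<close>
  becomes the identity. Each round removes one \<open>w\<close>.\<close>

lemma absorb_negative_part:
  assumes "\<And>b. (\<Sum>v\<leftarrow>vs. v * E (star v * b)) = b + (\<Sum>w\<leftarrow>ws. w * E (star w * b))"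
  shows "\<exists>us. \<forall>b. (\<Sum>u\<leftarrow>us. u * E (star u * b)) = b"
  using assms
proof (induction "length ws" arbitrary: vs ws)
  case (Suc n)
  then obtain w ws' where ws: "ws = w # ws'" "n = length ws'" by (cases ws) auto
  obtain F where F: "clinear F" "\<forall>b c. c \<in> C \<longrightarrow> F (b * c) = F b * c"
    "\<forall>a b. E (star (F a) * b) = E (star a * F b)"
    "\<forall>b. F (F b + w * E (star w * F b)) = b"
    by (rule rank_one_inverse_sqrt[of w])
  have F_add: "F (x + y) = F x + F y" for x y using F(1) by (simp add: clinear_iff)
  then have F_zero: "F 0 = 0" by (metis add_cancel_right_right)
  have F_sum: "F (\<Sum>x\<leftarrow>xs. x * E (star x * F b)) = (\<Sum>x\<leftarrow>map F xs. x * E (star x * b))" for xs b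
    by (induction xs) (simp_all add: F_zero F_add F(2)[rule_format, OF E_mem] F(3))
  show ?case
  proof (rule Suc.hyps(1))
    show "n = length (map F ws')" using ws(2) by simp
    fix b
    have "(\<Sum>v\<leftarrow>map F vs. v * E (star v * b))
      = F ((F b + w * E (star w * F b)) + (\<Sum>v\<leftarrow>ws'. v * E (star v * F b)))"
      unfolding F_sum[symmetric] by (simp add: Suc.prems[of "F b"] ws(1) add.assoc)
    then show "(\<Sum>v\<leftarrow>map F vs. v * E (star v * b)) = b + (\<Sum>v\<leftarrow>map F ws'. v * E (star v * b))"
      unfolding F_add[of "F b + w * E (star w * F b)"] F(4)[rule_format] F_sum .
  qed
qed auto

lemma quasi_basis_of_pairs:
  assumes ps: "\<And>b. (\<Sum>(x, y)\<leftarrow>ps. x * E (y * b)) = b"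
  obtains vs where "quasi_basis E vs" "(\<Sum>v\<leftarrow>vs. v * star v) = (\<Sum>(x, y)\<leftarrow>ps. x * y)"
proof -
  \<comment> \<open>The adjoint of the assumed identity with respect to the \<open>C\<close>-valued
    inner product.\<close>
  have adj: "(\<Sum>(x, y)\<leftarrow>ps. star y * E (star x * b)) = b" for b
  proof (rule E_eqI)
    fix c
    have "E (star c * (\<Sum>(x, y)\<leftarrow>qs. star y * E (star x * b)))
      = E (star (\<Sum>(x, y)\<leftarrow>qs. x * E (y * c)) * b)" for qs
    proof (induction qs)
      case (Cons q qs)
      obtain x y where q: "q = (x, y)" by (cases q)
      have "E (star c * (star y * E (star x * b))) = E (star c * star y) * E (star x * b)"
        by (simp only: mult.assoc[symmetric] E_right[OF E_mem])
      also have "\<dots> = E (star (x * E (y * c)) * b)"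
        by (simp add: star_mult E_star[symmetric] mult.assoc E_left[OF E_mem])
      finally show ?case using Cons by (simp add: q distrib_left distrib_right star_add E_add)
    qed (simp add: E_zero)
    then show "E (star c * (\<Sum>(x, y)\<leftarrow>ps. star y * E (star x * b))) = E (star c * b)"
      by (simp only: ps)
  qed
  have adj': "(\<Sum>(x, y)\<leftarrow>ps. E (b * x) * y) = b" for b
  proof -
    have "star (\<Sum>(x, y)\<leftarrow>ps. star y * E (star x * star b)) = (\<Sum>(x, y)\<leftarrow>ps. E (b * x) * y)"
      by (simp add: star_sum_list case_prod_unfold star_mult star_star E_star[symmetric])
    then show ?thesis by (simp only: adj star_star)
  qed
  \<comment> \<open>Polarisation: the rank-one terms of \<open>(x + star y) / 2\<close> and
    \<open>(x - star y) / 2\<close> differ by the mean of the terms in \<open>ps\<close> and in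
    \<open>adj\<close>, each of which sums to \<open>b\<close>.\<close>
  define pv where "pv = map (\<lambda>(x, y). (1/2) *\<^sub>C (x + star y)) ps"
  define pw where "pw = map (\<lambda>(x, y). (1/2) *\<^sub>C (x - star y)) ps"
  have half: "(1/2) *\<^sub>C z + (1/2) *\<^sub>C z = z" for z :: 'b
    by (simp add: scaleC_add_left[symmetric] scaleC_one)
  have "(\<Sum>v\<leftarrow>pv. v * E (star v * b)) = b + (\<Sum>w\<leftarrow>pw. w * E (star w * b))" for b
  proof -
    have quarter: "(1/4) *\<^sub>C (z + z) = (1/2) *\<^sub>C z" for z :: 'b
      by (simp add: scaleC_add_right scaleC_add_left[symmetric])
    have scale: "((1/2) *\<^sub>C z) * E (star ((1/2) *\<^sub>C z) * b) = (1/4) *\<^sub>C (z * E (star z * b))" for z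
      by (simp add: star_scaleC mult_scaleC_left mult_scaleC_right E_scaleC scaleC_scaleC)
    have pol: "(x + y) * E (star (x + y) * b) = (x - y) * E (star (x - y) * b)
      + ((x * E (star y * b) + y * E (star x * b)) + (x * E (star y * b) + y * E (star x * b)))" for x y
      by (simp add: star_add star_diff distrib_left distrib_right left_diff_distrib
          right_diff_distrib E_add E_diff)
    have "((1/2) *\<^sub>C (x + y)) * E (star ((1/2) *\<^sub>C (x + y)) * b)
      = ((1/2) *\<^sub>C (x - y)) * E (star ((1/2) *\<^sub>C (x - y)) * b)
        + ((1/2) *\<^sub>C (x * E (star y * b)) + (1/2) *\<^sub>C (y * E (star x * b)))" for x y
      unfolding scale pol[of x y] by (simp only: scaleC_add_right[of "1/4" "_ * E _"] quarter)
        (simp only: scaleC_add_right)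
    from this[of _ "star _"]
    have step: "((1/2) *\<^sub>C (x + star y)) * E (star ((1/2) *\<^sub>C (x + star y)) * b)
      = ((1/2) *\<^sub>C (x - star y)) * E (star ((1/2) *\<^sub>C (x - star y)) * b)
        + ((1/2) *\<^sub>C (x * E (y * b)) + (1/2) *\<^sub>C (star y * E (star x * b)))" for x y
      by (simp only: star_star)
    have "(\<Sum>v\<leftarrow>map (\<lambda>(x, y). (1/2) *\<^sub>C (x + star y)) qs. v * E (star v * b))
      = ((1/2) *\<^sub>C (\<Sum>(x, y)\<leftarrow>qs. x * E (y * b))
        + (1/2) *\<^sub>C (\<Sum>(x, y)\<leftarrow>qs. star y * E (star x * b)))
        + (\<Sum>w\<leftarrow>map (\<lambda>(x, y). (1/2) *\<^sub>C (x - star y)) qs. w * E (star w * b))" for qs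
    proof (induction qs)
      case (Cons q qs)
      show ?case
        by (cases q) (simp only: list.map sum_list.Cons prod.case Cons step
            scaleC_add_right[of "1/2" "_ * E _"] add_ac)
    qed simp
    from this[of ps] show ?thesis by (simp only: pv_def pw_def ps adj half)
  qed
  then obtain vs where vs: "\<And>b. (\<Sum>v\<leftarrow>vs. v * E (star v * b)) = b"
    using absorb_negative_part[of pv pw] by auto
  have vs': "(\<Sum>v\<leftarrow>vs. E (b * v) * star v) = b" for b
  proof -
    have "star (\<Sum>v\<leftarrow>vs. v * E (star v * star b)) = (\<Sum>v\<leftarrow>vs. E (b * v) * star v)"
      by (simp add: star_sum_list star_mult star_star E_star[symmetric])
    then show ?thesis by (simp only: vs star_star)
  qed
  have "quasi_basis E vs" by (simp add: quasi_basis_def vs vs')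
  moreover have "(\<Sum>v\<leftarrow>vs. v * star v) = (\<Sum>(x, y)\<leftarrow>ps. x * y)"
  proof -
    \<comment> \<open>As for the independence of the index: expand \<open>star v\<close> by
      \<open>adj'\<close>, interchange the sums, and contract with the quasi-basis.\<close>
    have swap: "(\<Sum>v\<leftarrow>us. v * (\<Sum>(x, y)\<leftarrow>qs. E (star v * x) * y))
      = (\<Sum>(x, y)\<leftarrow>qs. (\<Sum>v\<leftarrow>us. v * E (star v * x)) * y)" for us qs
      by (induction qs)
        (auto simp: case_prod_unfold distrib_left sum_list_addf mult.assoc sum_list_mult_const[symmetric])
    have "(\<Sum>v\<leftarrow>vs. v * star v) = (\<Sum>v\<leftarrow>vs. v * (\<Sum>(x, y)\<leftarrow>ps. E (star v * x) * y))"
      by (simp only: adj')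
    then show ?thesis by (simp only: swap vs)
  qed
  ultimately show ?thesis by (rule that)
qed

end

section \<open>The canonical conditional expectation of an action\<close>

lemma sum_list_scaleC: "(\<Sum>v\<leftarrow>vs. c *\<^sub>C f v) = c *\<^sub>C (\<Sum>v\<leftarrow>vs. f v)"
  by (induction vs) (simp_all add: scaleC_add_right)

lemma sum_sum_list_swap: "(\<Sum>g\<in>G. \<Sum>v\<leftarrow>vs. f g v) = (\<Sum>v\<leftarrow>vs. \<Sum>g\<in>G. f g v)"
  by (induction vs) (simp_all add: sum.distrib)

lemma tensor_lift_sum_list_fun:
  "tensor_lift (\<lambda>x y. \<Sum>v\<leftarrow>vs. f v x y) t = (\<Sum>v\<leftarrow>vs. tensor_lift (f v) t)"
  by (induction vs) (simp_all add: tensor_lift_zero_fun tensor_lift_add_fun)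

section \<open>Fixed points and their bimodule property\<close>

context hopf_action
begin

lemma act_linear: "clinear (act a)" and act_linear_left: "clinear (\<lambda>a. act a x)"
  using act_bilinear by (simp_all add: cbilinear_def)

lemma act_zero: "act a 0 = 0"
  by (rule clinear_zero[OF act_linear])

lemma cbilinear_act_mult: "cbilinear (\<lambda>a b. act a x * act b y)"
  by (rule cbilinear_compose[OF cbilinear_mult act_linear_left act_linear_left])

lemma act_S_star: "act (S (star a)) (star x) = star (act a x)"
  by (rule act_star[symmetric])

lemma fixed_pointD: "c \<in> fixed_point_algebra \<epsilon> act \<Longrightarrow> act a c = \<epsilon> a *\<^sub>C c"
  by (simp add: fixed_point_algebra_def)

lemma one_fixed: "1 \<in> fixed_point_algebra \<epsilon> act"
  by (simp add: fixed_point_algebra_def act_one_right)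

text \<open>On a fixed point the first leg of \<open>\<Delta> a\<close> acts through the counit,
  which leaves \<open>a\<close> acting on \<open>x\<close>.\<close>

lemma act_fixed_left:
  assumes "c \<in> fixed_point_algebra \<epsilon> act"
  shows "act a (c * x) = c * act a x"
proof -
  have "act a (c * x) = tensor_lift (\<lambda>l r. c * act (\<epsilon> l *\<^sub>C r) x) (\<Delta> a)"
    by (simp add: act_mult_right fixed_pointD[OF assms] act_scaleC_left mult_scaleC_left
        mult_scaleC_right)
  also have "\<dots> = c * act (tensor_lift (\<lambda>l r. \<epsilon> l *\<^sub>C r) (\<Delta> a)) x"
    by (rule clinear_tensor_lift_comp[symmetric])
      (simp_all add: clinear_iff cbilinear_iff act_add_left act_scaleC_left distrib_left
        mult_scaleC_right scaleC_add_left scaleC_add_right scaleC_scaleC clinear_add[OF eps_linear]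
        clinear_scaleC[OF eps_linear] scaleC_complex_def mult.commute)
  finally show ?thesis by (simp only: counit_left')
qed

lemma act_fixed_right:
  assumes "c \<in> fixed_point_algebra \<epsilon> act"
  shows "act a (x * c) = act a x * c"
proof -
  have "act a (x * c) = tensor_lift (\<lambda>l r. act (\<epsilon> r *\<^sub>C l) x * c) (\<Delta> a)"
    by (simp add: act_mult_right fixed_pointD[OF assms] act_scaleC_left mult_scaleC_left
        mult_scaleC_right)
  also have "\<dots> = act (tensor_lift (\<lambda>l r. \<epsilon> r *\<^sub>C l) (\<Delta> a)) x * c"
    by (rule clinear_tensor_lift_comp[symmetric])
      (simp_all add: clinear_iff cbilinear_iff act_add_left act_scaleC_left distrib_right
        mult_scaleC_left scaleC_add_left scaleC_add_right scaleC_scaleC clinear_add[OF eps_linear]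
        clinear_scaleC[OF eps_linear] scaleC_complex_def mult.commute)
  finally show ?thesis by (simp only: counit_right')
qed

end

text \<open>The basis and trace supplied by \<open>orthonormal_expansion\<close> become parameters,
  so that \<open>\<Delta> e\<close> is available as an explicit finite sum.\<close>

locale diagonal_action = hopf_action \<Delta> \<epsilon> S act + hopf_projection \<Delta> \<epsilon> S e
  for \<Delta> :: "'a::cstar_algebra \<Rightarrow> ('a, 'a) tensor" and \<epsilon> :: "'a \<Rightarrow> complex" and S :: "'a \<Rightarrow> 'a"
    and act :: "'a \<Rightarrow> 'm::cstar_algebra \<Rightarrow> 'm" and e :: 'a +
  fixes G :: "'a set" and \<tau> :: "'a \<Rightarrow> complex"
  assumes finite_G: "finite G"
    and \<tau>_linear: "clinear \<tau>"
    and \<tau>_commute: "\<tau> (x * y) = \<tau> (y * x)"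
    and \<tau>_one: "\<tau> 1 = of_nat (complex_vector.dim (UNIV :: 'a set))"
    and \<tau>_orthonormal: "g \<in> G \<Longrightarrow> h \<in> G \<Longrightarrow> \<tau> (g * star h) = (if g = h then 1 else 0)"
    and expansion: "x = (\<Sum>g\<in>G. \<tau> (x * star g) *\<^sub>C g)"
    and Delta_e: "\<Delta> e = (\<Sum>g\<in>G. S (star g) \<otimes>\<^sub>C g)"
begin

abbreviation fixed :: "'m set" where
  "fixed \<equiv> fixed_point_algebra \<epsilon> act"

lemma \<tau>_scaleC: "\<tau> (c *\<^sub>C x) = c * \<tau> x"
  by (simp add: clinear_scaleC[OF \<tau>_linear] scaleC_complex_def)

lemma act_expansion: "act a x = (\<Sum>g\<in>G. \<tau> (a * star g) *\<^sub>C act g x)"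
proof -
  have "act a x = act (\<Sum>g\<in>G. \<tau> (a * star g) *\<^sub>C g) x" by (simp only: expansion[symmetric])
  also have "\<dots> = (\<Sum>g\<in>G. \<tau> (a * star g) *\<^sub>C act g x)"
    by (simp add: clinear_sum[OF act_linear_left] act_scaleC_left)
  finally show ?thesis .
qed

lemma \<tau>_star: "\<tau> (star a) = (\<Sum>g\<in>G. cnj (\<tau> (a * star g)) * \<tau> (star g))"
proof -
  have "star a = star (\<Sum>g\<in>G. \<tau> (a * star g) *\<^sub>C g)" by (simp only: expansion[symmetric])
  also have "\<dots> = (\<Sum>g\<in>G. cnj (\<tau> (a * star g)) *\<^sub>C star g)"
    by (simp only: star_sum star_scaleC)
  finally show ?thesis by (simp add: clinear_sum[OF \<tau>_linear] \<tau>_scaleC)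
qed

text \<open>Parseval's identity for the unit of the Hopf algebra.\<close>

lemma sum_norm_coefficients: "(\<Sum>g\<in>G. cnj (\<tau> (star g)) * \<tau> (star g)) = \<tau> 1"
  using \<tau>_star[of 1] by simp

section \<open>The action of \<open>e\<close> as a faithful conditional expectation\<close>

lemma tensor_lift_Delta_e_sum:
  assumes "cbilinear f"
  shows "tensor_lift f (\<Delta> e) = (\<Sum>g\<in>G. f (S (star g)) g)"
  by (simp add: Delta_e clinear_sum[OF clinear_tensor_lift[OF assms]] tensor_lift_pure[OF assms])

lemma act_e_mult: "act e (x * y) = (\<Sum>g\<in>G. act (S (star g)) x * act g y)"
  unfolding act_mult_right by (rule tensor_lift_Delta_e_sum[OF cbilinear_act_mult])

lemma act_e_star_mult: "act e (star x * y) = (\<Sum>g\<in>G. star (act g x) * act g y)"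
  by (simp add: act_e_mult act_S_star)

lemma act_e_fixed: "act e x \<in> fixed"
  by (simp add: fixed_point_algebra_def act_mult_left[symmetric] e_absorb act_scaleC_left)

lemma fixed_iff: "x \<in> fixed \<longleftrightarrow> act e x = x"
  using act_e_fixed[of x] fixed_pointD[of x e] by (auto simp: eps_e scaleC_one)

lemma act_e_star: "act e (star x) = star (act e x)"
proof -
  \<comment> \<open>Setting \<open>x = 1\<close>, respectively \<open>y = 1\<close>, in
    \<open>act_e_star_mult\<close> expresses \<open>act e y\<close> and
    \<open>act e (star x)\<close> through the same element \<open>k\<close>.\<close>
  define k where "k = (\<Sum>g\<in>G. cnj (\<epsilon> g) *\<^sub>C g)"
  have k: "act k y = (\<Sum>g\<in>G. cnj (\<epsilon> g) *\<^sub>C act g y)" for y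
    by (simp add: k_def clinear_sum[OF act_linear_left] act_scaleC_left)
  have "act e y = act k y" for y
    using act_e_star_mult[of 1 y] by (simp add: k act_one_right star_scaleC mult_scaleC_left)
  moreover have "act e (star x) = star (act k x)"
    using act_e_star_mult[of x 1]
    by (simp add: k act_one_right star_scaleC mult_scaleC_right star_sum)
  ultimately show ?thesis by simp
qed

lemma act_e_positive: "norm_positive (act e (star x * x))"
  unfolding act_e_star_mult by (intro norm_positive_sum norm_positive_star_mult)

text \<open>A vanishing sum of squares forces \<open>act g x = 0\<close> for every \<open>g\<close>
  in the basis, and the unit is a combination of these \<open>g\<close>.\<close>

lemma act_e_faithful:
  assumes "act e (star x * x) = 0"
  shows "x = 0"
proof -
  have "act g x = 0" if "g \<in> G" for g
    by (rule sum_star_mult_eq_0D[OF finite_G _ that]) (use assms in \<open>simp add: act_e_star_mult\<close>)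
  then have "act 1 x = 0" unfolding act_expansion[of 1] by simp
  then show ?thesis by (simp add: act_one_left)
qed

lemma act_e_diff: "act e (x - y) = act e x - act e y"
  using act_add_right[of e "x - y" y] by simp

text \<open>A Kadison-Schwarz argument with \<open>y = act e x\<close>. Positivity at
  \<open>x - y\<close> bounds \<open>star y * y\<close> by \<open>act e (star x * x)\<close>, which
  is at most the squared norm of \<open>x\<close>. The resulting continuity of \<open>act e\<close>
  makes the fixed point algebra closed.\<close>

lemma norm_act_e_le: "norm (act e x) \<le> norm x"
proof (cases "x = 0")
  case False
  define s where "s = (norm x)\<^sup>2"
  have s: "s > 0" using False by (simp add: s_def)
  have "norm_positive (s *\<^sub>R 1 - star x * x)"
    by (rule norm_positive_diff_norm) (simp_all add: s star_mult star_star norm_star_mult, simp add: s_def)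
  then obtain r where r: "norm_positive r" "r * r = s *\<^sub>R 1 - star x * x"
    by (rule norm_positive_sqrt_commute)
  have "act e (star r * r) = s *\<^sub>R 1 - act e (star x * x)"
    unfolding norm_positive_self_adjoint[OF r(1)] r(2) act_e_diff
    by (simp add: scaleR_scaleC act_scaleC_right act_one_right eps_e scaleC_one)
  then have 1: "norm_positive (s *\<^sub>R 1 - act e (star x * x))"
    using act_e_positive[of r] by simp
  define y where "y = act e x"
  have y: "y \<in> fixed" "star y \<in> fixed"
    unfolding y_def act_e_star[symmetric] by (rule act_e_fixed)+
  have "act e (star (x - y) * (x - y)) = act e (star x * x) - star y * y"
    using y by (simp add: star_diff left_diff_distrib right_diff_distrib act_e_diff act_fixed_left
        act_fixed_right act_e_star fixed_iff y_def[symmetric])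
  then have 2: "norm_positive (act e (star x * x) - star y * y)"
    using act_e_positive[of "x - y"] by simp
  have "norm_positive (s *\<^sub>R 1 - star y * y)"
    using norm_positive_add[OF 1 2] by simp
  then have "norm (star y * y) \<le> s"
    using s by (intro norm_le_of_norm_positive norm_positive_star_mult) auto
  then have "(norm y)\<^sup>2 \<le> (norm x)\<^sup>2" by (simp add: norm_star_mult s_def)
  then show ?thesis unfolding y_def by (rule power2_le_imp_le) simp
qed (simp add: act_zero)

lemma closed_fixed: "closed fixed"
proof -
  have "bounded_linear (act e)"
    by (rule bounded_linear_intro[where K=1])
      (simp_all add: act_add_right scaleR_scaleC act_scaleC_right norm_act_e_le)
  then have "closed {x. act e x = x}"
    by (intro closed_Collect_eq continuous_intros linear_continuous_on)
  then show ?thesis by (simp add: fixed_iff[symmetric])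
qed

lemma faithful_conditional_expectation_act_e: "faithful_conditional_expectation (act e) fixed"
  unfolding faithful_conditional_expectation_def cstar_subalgebra_def
proof (intro conjI ballI allI impI)
  show "complex_vector.subspace fixed"
    by (auto simp: complex_vector.subspace_def fixed_iff act_zero act_add_right act_scaleC_right)
  show "x * y \<in> fixed" if "x \<in> fixed" "y \<in> fixed" for x y
    using that by (simp add: fixed_iff act_fixed_left)
  show "star x \<in> fixed" if "x \<in> fixed" for x
    using that by (simp add: fixed_iff act_e_star)
  show "range (act e) = fixed"
    using act_e_fixed by (auto simp: fixed_iff intro: range_eqI[OF HOL.sym])
  show "act e c = c" if "c \<in> fixed" for c using that by (simp add: fixed_iff)
  show "act e (c * x * d) = c * act e x * d" if "c \<in> fixed" "d \<in> fixed" for c x d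
    using that by (simp add: act_fixed_left act_fixed_right)
  show "positive_element (act e (star x * x))" for x
    by (simp add: positive_element_iff act_e_positive)
  show "x = 0" if "act e (star x * x) = 0" for x
    using that by (rule act_e_faithful)
qed (rule one_fixed act_linear closed_fixed)+

sublocale conditional_expectation "act e" fixed
  by unfold_locales (rule faithful_conditional_expectation_act_e)

section \<open>Products x e y in the crossed product and their span\<close>

definition xey :: "'m \<Rightarrow> 'm \<Rightarrow> ('m, 'a) tensor" where
  "xey x y = crossed_mult \<Delta> act (crossed_mult \<Delta> act (x \<otimes>\<^sub>C 1) (1 \<otimes>\<^sub>C e)) (y \<otimes>\<^sub>C 1)"

lemma xey_eq: "xey x y = (\<Sum>g\<in>G. (x * act (S (star g)) y) \<otimes>\<^sub>C g)"
proof -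
  have "crossed_mult \<Delta> act (x \<otimes>\<^sub>C 1) (1 \<otimes>\<^sub>C e) = x \<otimes>\<^sub>C e"
    by (simp add: crossed_mult_pure Delta_one tensor_lift_pure[OF cbilinear_crossed_1] act_one_left)
  then show ?thesis
    unfolding xey_def
    by (simp only: crossed_mult_pure tensor_lift_Delta_e_sum[OF cbilinear_crossed_1]) simp
qed

lemma saturated_iff:
  "saturated \<Delta> act e \<longleftrightarrow> complex_vector.span {xey x y | x y. True} = UNIV"
  unfolding saturated_def xey_def by (simp only: eq_commute)

text \<open>Scalars are absorbed into the left factor, so plain finite sums suffice.\<close>

lemma span_xey:
  assumes "t \<in> complex_vector.span {xey x y | x y. True}"
  obtains ps where "t = (\<Sum>(x, y)\<leftarrow>ps. xey x y)"
proof -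
  have "\<exists>ps. t = (\<Sum>(x, y)\<leftarrow>ps. xey x y)"
    using assms
  proof (induction rule: complex_vector.span_induct_alt)
    case base
    show ?case by (rule exI[of _ "[]"]) simp
  next
    case (step c t' t)
    then obtain x y ps where t: "t' = xey x y" "t = (\<Sum>(x, y)\<leftarrow>ps. xey x y)" by blast
    have "c *\<^sub>C xey x y = xey (c *\<^sub>C x) y"
      by (simp add: xey_eq complex_vector.scale_sum_right tensor_scaleC_left mult_scaleC_left)
    then show ?case using t by (intro exI[of _ "(c *\<^sub>C x, y) # ps"]) simp
  qed
  then obtain ps where "t = (\<Sum>(x, y)\<leftarrow>ps. xey x y)" by (rule exE)
  then show ?thesis by (rule that)
qed

section \<open>From saturation to a quasi-basis and its index\<close>

lemma saturated_imp:
  assumes "saturated \<Delta> act e"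
  shows "\<exists>vs. quasi_basis (act e) vs"
    and "Index (act e) = of_nat (complex_vector.dim (UNIV :: 'a set)) *\<^sub>C 1"
proof -
  obtain ps where ps: "1 \<otimes>\<^sub>C 1 = (\<Sum>(x, y)\<leftarrow>ps. xey x y)"
    using assms span_xey[of "1 \<otimes>\<^sub>C 1"] unfolding saturated_iff by blast
  have coeff: "(\<Sum>(x, y)\<leftarrow>ps. x * act (S (star h)) y) = \<tau> (star h) *\<^sub>C 1" if h: "h \<in> G" for h
  proof -
    \<comment> \<open>By orthonormality, pairing the second factor with \<open>h\<close> extracts
      the coefficient of \<open>h\<close>.\<close>
    define K where "K = tensor_lift (\<lambda>(x::'m) a. \<tau> (a * star h) *\<^sub>C x)"
    have b: "cbilinear (\<lambda>(x::'m) a. \<tau> (a * star h) *\<^sub>C x)"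
      by (simp add: cbilinear_iff distrib_right mult_scaleC_left clinear_add[OF \<tau>_linear] \<tau>_scaleC
          scaleC_add_left scaleC_add_right scaleC_scaleC mult.commute)
    have K: "clinear K" unfolding K_def by (rule clinear_tensor_lift[OF b])
    have K_pure: "K (x \<otimes>\<^sub>C a) = \<tau> (a * star h) *\<^sub>C x" for x a
      unfolding K_def by (rule tensor_lift_pure[OF b])
    have "K (xey x y) = x * act (S (star h)) y" for x y
    proof -
      have "K (xey x y) = (\<Sum>g\<in>G. if g = h then x * act (S (star g)) y else 0)"
        unfolding xey_eq clinear_sum[OF K]
        by (rule sum.cong) (auto simp: K_pure \<tau>_orthonormal h scaleC_one)
      then show ?thesis using h finite_G by simp
    qed
    then have "K (1 \<otimes>\<^sub>C 1) = (\<Sum>(x, y)\<leftarrow>ps. x * act (S (star h)) y)"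
      unfolding ps clinear_sum_list[OF K] by (simp add: case_prod_unfold)
    then show ?thesis by (simp add: K_pure)
  qed
  have basis: "(\<Sum>(x, y)\<leftarrow>ps. x * act e (y * b)) = b" for b
  proof -
    have "(\<Sum>(x, y)\<leftarrow>ps. x * act e (y * b))
      = (\<Sum>g\<in>G. \<Sum>(x, y)\<leftarrow>ps. x * act (S (star g)) y * act g b)"
      by (simp add: act_e_mult sum_distrib_left sum_sum_list_swap case_prod_unfold mult.assoc)
    also have "\<dots> = (\<Sum>g\<in>G. (\<Sum>(x, y)\<leftarrow>ps. x * act (S (star g)) y) * act g b)"
      by (simp add: sum_list_mult_const[symmetric] case_prod_unfold)
    also have "\<dots> = (\<Sum>g\<in>G. \<tau> (1 * star g) *\<^sub>C act g b)"
      by (rule sum.cong) (simp_all add: coeff mult_scaleC_left)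
    also have "\<dots> = b" by (simp only: act_expansion[symmetric] act_one_left)
    finally show ?thesis .
  qed
  obtain vs where vs: "quasi_basis (act e) vs"
    "(\<Sum>v\<leftarrow>vs. v * star v) = (\<Sum>(x, y)\<leftarrow>ps. x * y)"
    by (rule quasi_basis_of_pairs[OF basis])
  \<comment> \<open>Applying \<open>star\<close> and \<open>S\<close> to the expansion of the unit
    gives an expansion in the elements \<open>S (star g)\<close>, for which \<open>coeff\<close> is
    available.\<close>
  have one: "1 = (\<Sum>g\<in>G. cnj (\<tau> (star g)) *\<^sub>C S (star g))"
  proof -
    have "S (star 1) = S (star (\<Sum>g\<in>G. \<tau> (1 * star g) *\<^sub>C g))" by (simp only: expansion[symmetric])
    then show ?thesis
      by (simp add: star_sum star_scaleC clinear_sum[OF S_linear] clinear_scaleC[OF S_linear] S_one)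
  qed
  have y: "y = (\<Sum>g\<in>G. cnj (\<tau> (star g)) *\<^sub>C act (S (star g)) y)" for y
    using arg_cong[OF one, of "\<lambda>a. act a y"]
    by (simp add: act_one_left clinear_sum[OF act_linear_left] act_scaleC_left)
  have "(\<Sum>(x, y)\<leftarrow>ps. x * y)
    = (\<Sum>(x, y)\<leftarrow>ps. x * (\<Sum>g\<in>G. cnj (\<tau> (star g)) *\<^sub>C act (S (star g)) y))"
    by (simp only: y[symmetric])
  also have "\<dots> = (\<Sum>g\<in>G. cnj (\<tau> (star g)) *\<^sub>C (\<Sum>(x, y)\<leftarrow>ps. x * act (S (star g)) y))"
    by (simp add: sum_distrib_left case_prod_unfold mult_scaleC_right sum_list_scaleC[symmetric]
        sum_sum_list_swap)
  also have "\<dots> = (\<Sum>g\<in>G. (cnj (\<tau> (star g)) * \<tau> (star g)) *\<^sub>C 1)"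
    by (rule sum.cong) (simp_all add: coeff scaleC_scaleC)
  also have "\<dots> = \<tau> 1 *\<^sub>C 1"
    by (simp only: complex_vector.scale_sum_left[symmetric] sum_norm_coefficients)
  finally show "Index (act e) = of_nat (complex_vector.dim (UNIV :: 'a set)) *\<^sub>C 1"
    using Index_eq[OF vs(1)] vs(2) \<tau>_one by simp
  show "\<exists>vs. quasi_basis (act e) vs" using vs(1) by blast
qed

section \<open>From the value of the index to saturation\<close>

context
  fixes vs :: "'m list"
  assumes vs: "quasi_basis (act e) vs"
    and index: "(\<Sum>v\<leftarrow>vs. v * star v) = \<tau> 1 *\<^sub>C 1"
begin

text \<open>
  The coefficients \<open>p\<^sub>g = \<Sum> v (g \<cdot> v)\<^sup>*\<close> of \<open>\<Sum> v e v\<^sup>*\<close> satisfy \<open>\<Sum> p\<^sub>g p\<^sub>g\<^sup>* = Index E\<close>, so the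
  hypothesis on the index forces \<open>p\<^sub>g\<close> to equal the coefficient of \<open>1 \<otimes> 1\<close>.
\<close>

lemma coefficients_of_one:
  assumes "g \<in> G"
  shows "(\<Sum>v\<leftarrow>vs. v * star (act g v)) = \<tau> (star g) *\<^sub>C 1"
proof -
  define p where "p g = (\<Sum>v\<leftarrow>vs. v * star (act g v))" for g
  define l where "l g = \<tau> (star g)" for g
  have real: "star (\<tau> 1 *\<^sub>C 1 :: 'm) = \<tau> 1 *\<^sub>C 1" by (simp add: \<tau>_one star_scaleC)
  have qb: "(\<Sum>v\<leftarrow>vs. v * act e (star v * w)) = w" for w
    using vs unfolding quasi_basis_def by metis
  have p_mult: "p g * b = (\<Sum>v\<leftarrow>vs. v * (star (act g v) * b))" for g b
    by (simp add: p_def sum_list_mult_const[symmetric] mult.assoc)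
  have "p g * star (p g) = (\<Sum>w\<leftarrow>vs. (\<Sum>v\<leftarrow>vs. v * (star (act g v) * act g w)) * star w)" for g
  proof -
    have "star (p g) = (\<Sum>w\<leftarrow>vs. act g w * star w)"
      by (simp add: p_def star_sum_list star_mult star_star)
    then have "p g * star (p g) = (\<Sum>w\<leftarrow>vs. (p g * act g w) * star w)"
      by (simp add: sum_list_const_mult[symmetric] mult.assoc)
    then show ?thesis by (simp only: p_mult)
  qed
  \<comment> \<open>Summed over \<open>G\<close>, the inner products form
    \<open>act e (star v * w)\<close>; the quasi-basis identity then contracts the sum over
    \<open>v\<close> to \<open>w\<close>, leaving the index.\<close>
  then have "(\<Sum>g\<in>G. p g * star (p g))
    = (\<Sum>w\<leftarrow>vs. (\<Sum>v\<leftarrow>vs. v * (\<Sum>g\<in>G. star (act g v) * act g w)) * star w)"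
    by (simp only: sum_sum_list_swap sum_distrib_left[symmetric] sum_distrib_right[symmetric])
  then have pp: "(\<Sum>g\<in>G. p g * star (p g)) = \<tau> 1 *\<^sub>C 1"
    by (simp only: act_e_star_mult[symmetric] qb index)
  have "(\<Sum>g\<in>G. cnj (l g) *\<^sub>C p g) = (\<Sum>v\<leftarrow>vs. v * star (\<Sum>g\<in>G. \<tau> (1 * star g) *\<^sub>C act g v))"
    by (simp add: p_def l_def sum_list_scaleC[symmetric] sum_sum_list_swap star_sum star_scaleC
        sum_distrib_left mult_scaleC_right)
  then have lp: "(\<Sum>g\<in>G. cnj (l g) *\<^sub>C p g) = \<tau> 1 *\<^sub>C 1"
    by (simp only: act_expansion[symmetric] act_one_left index)
  have pl: "(\<Sum>g\<in>G. l g *\<^sub>C star (p g)) = \<tau> 1 *\<^sub>C 1"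
    using arg_cong[OF lp, of star] unfolding real by (simp add: star_sum star_scaleC)
  have ll: "(\<Sum>g\<in>G. (cnj (l g) * l g) *\<^sub>C 1) = \<tau> 1 *\<^sub>C (1::'m)"
    by (simp only: complex_vector.scale_sum_left[symmetric] sum_norm_coefficients l_def)
  \<comment> \<open>After summation over \<open>G\<close> each of the four terms is
    \<open>\<tau> 1\<close> times the unit up to sign, and the signs cancel.\<close>
  have "star (star (p g - l g *\<^sub>C 1)) * star (p g - l g *\<^sub>C 1)
    = p g * star (p g) - cnj (l g) *\<^sub>C p g - l g *\<^sub>C star (p g) + (cnj (l g) * l g) *\<^sub>C 1" for g
    by (simp add: star_star star_diff star_scaleC left_diff_distrib right_diff_distrib
        mult_scaleC_left mult_scaleC_right scaleC_scaleC mult.commute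
        complex_vector.scale_right_diff_distrib)
  then have "(\<Sum>g\<in>G. star (star (p g - l g *\<^sub>C 1)) * star (p g - l g *\<^sub>C 1)) = 0"
    by (simp only: sum.distrib sum_subtractf pp lp pl ll) simp
  then have "star (p g - l g *\<^sub>C 1) = 0"
    by (rule sum_star_mult_eq_0D[OF finite_G _ assms])
  then have "p g - l g *\<^sub>C 1 = 0" by (metis star_star star_zero)
  then show ?thesis by (simp add: p_def l_def)
qed

lemma sum_mult_act_star: "(\<Sum>v\<leftarrow>vs. v * act c (star v)) = \<tau> (S c) *\<^sub>C 1"
proof -
  \<comment> \<open>With this choice \<open>act c (star v)\<close> is \<open>star (act d v)\<close>,
    and expanding \<open>d\<close> in \<open>G\<close> reduces to
    \<open>coefficients_of_one\<close>.\<close>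
  define d where "d = star (S c)"
  have c: "c = S (star d)" by (simp add: d_def star_star S_S)
  have "(\<Sum>v\<leftarrow>vs. v * star (act d v)) = (\<Sum>g\<in>G. cnj (\<tau> (d * star g)) *\<^sub>C (\<Sum>v\<leftarrow>vs. v * star (act g v)))"
    unfolding act_expansion[of d]
    by (simp add: sum_list_scaleC[symmetric] sum_sum_list_swap star_sum star_scaleC
        sum_distrib_left mult_scaleC_right)
  also have "\<dots> = (\<Sum>g\<in>G. (cnj (\<tau> (d * star g)) * \<tau> (star g)) *\<^sub>C 1)"
    by (rule sum.cong) (simp_all add: coefficients_of_one scaleC_scaleC)
  also have "\<dots> = \<tau> (star d) *\<^sub>C 1"
    by (simp only: complex_vector.scale_sum_left[symmetric] \<tau>_star[of d, symmetric])
  finally show ?thesis by (simp add: c act_S_star S_S)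
qed

text \<open>By \<open>Delta_antipode\<close>, \<open>a \<otimes>\<^sub>C c\<close> is a Sweedler sum
  of terms \<open>\<Delta> x * (1 \<otimes>\<^sub>C d)\<close> with \<open>d = S y * c\<close>. On
  such a term the sum is \<open>act x\<close> applied to a sum that \<open>sum_mult_act_star\<close>
  shows to be scalar, so only \<open>\<epsilon> x\<close> remains and the counit recombines
  \<open>a\<close>.\<close>

lemma sum_act_mult_act_star: "(\<Sum>v\<leftarrow>vs. act a v * act c (star v)) = \<tau> (S c * a) *\<^sub>C 1"
proof -
  define P where "P = tensor_lift (\<lambda>x y. \<Sum>v\<leftarrow>vs. act x v * act y (star v))"
  have b: "cbilinear (\<lambda>x y. \<Sum>v\<leftarrow>vs. act x v * act y (star v))"
    by (simp add: cbilinear_iff act_add_left act_scaleC_left distrib_left distrib_right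
        mult_scaleC_left mult_scaleC_right sum_list_addf sum_list_scaleC)
  have b': "cbilinear (\<lambda>x y. \<Sum>v\<leftarrow>vs. act x v * act (y * d) (star v))" for d
    by (rule cbilinear_compose[OF b clinear_id(2) clinear_mult_right])
  have P: "clinear P" unfolding P_def by (rule clinear_tensor_lift[OF b])
  have P_pure: "P (x \<otimes>\<^sub>C y) = (\<Sum>v\<leftarrow>vs. act x v * act y (star v))" for x y
    unfolding P_def by (rule tensor_lift_pure[OF b])
  have P_mult: "P (u * (1 \<otimes>\<^sub>C d)) = tensor_lift (\<lambda>x y. \<Sum>v\<leftarrow>vs. act x v * act (y * d) (star v)) u" for u d
    by (induction u)
      (simp_all add: tensor_mult_pure P_pure clinear_add[OF P] clinear_zero[OF P] distrib_right
        tensor_lift_pure[OF b'] tensor_lift_add[OF b'] tensor_lift_zero[OF b'])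
  have P_Delta: "P (\<Delta> x * (1 \<otimes>\<^sub>C d)) = (\<epsilon> x * \<tau> (S d)) *\<^sub>C 1" for x d
  proof -
    have "P (\<Delta> x * (1 \<otimes>\<^sub>C d)) = (\<Sum>v\<leftarrow>vs. act x (v * act d (star v)))"
      by (simp add: P_mult tensor_lift_sum_list_fun act_mult_right act_mult_left)
    also have "\<dots> = act x (\<Sum>v\<leftarrow>vs. v * act d (star v))"
      by (rule clinear_sum_list[OF act_linear, symmetric])
    finally show ?thesis
      by (simp add: sum_mult_act_star act_scaleC_right act_one_right scaleC_scaleC mult.commute)
  qed
  have lin: "clinear (\<lambda>t. P (t * (1 \<otimes>\<^sub>C c)))"
    by (simp add: clinear_iff distrib_right mult_scaleC_left clinear_add[OF P] clinear_scaleC[OF P])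
  have lin': "clinear (\<lambda>y. \<tau> (S c * y) *\<^sub>C (1::'m))"
    by (simp add: clinear_iff distrib_left mult_scaleC_right clinear_add[OF \<tau>_linear] \<tau>_scaleC
        scaleC_add_left scaleC_scaleC)
  have "P (a \<otimes>\<^sub>C c) = P ((a \<otimes>\<^sub>C 1) * (1 \<otimes>\<^sub>C c))" by (simp add: tensor_mult_pure)
  also have "\<dots> = tensor_lift (\<lambda>x y. P (\<Delta> x * (1 \<otimes>\<^sub>C S y) * (1 \<otimes>\<^sub>C c))) (\<Delta> a)"
    unfolding Delta_antipode[of a, symmetric]
    by (rule clinear_tensor_lift_comp[OF cbilinear_Delta_mult lin])
  also have "\<dots> = tensor_lift (\<lambda>x y. \<tau> (S c * (\<epsilon> x *\<^sub>C y)) *\<^sub>C 1) (\<Delta> a)"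
    by (simp add: mult.assoc tensor_mult_pure P_Delta S_antimult S_S mult_scaleC_right \<tau>_scaleC)
  also have "\<dots> = \<tau> (S c * tensor_lift (\<lambda>x y. \<epsilon> x *\<^sub>C y) (\<Delta> a)) *\<^sub>C 1"
    by (rule clinear_tensor_lift_comp[OF _ lin', symmetric])
      (simp add: cbilinear_iff scaleC_add_right scaleC_add_left scaleC_scaleC
        clinear_add[OF eps_linear] clinear_scaleC[OF eps_linear] scaleC_complex_def mult.commute)
  finally show ?thesis by (simp only: P_pure counit_left')
qed

text \<open>Each \<open>x \<otimes>\<^sub>C a\<close> is the sum of the products of
  \<open>x * act a v\<close>, \<open>e\<close> and \<open>star v\<close>. The coefficient of
  \<open>g\<close> in this sum is \<open>\<tau> (a * star g)\<close> times \<open>x\<close>, which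
  reproduces the expansion of \<open>a\<close> in \<open>G\<close>.\<close>

lemma saturated_if_index: "saturated \<Delta> act e"
proof -
  have expand: "x \<otimes>\<^sub>C a = (\<Sum>v\<leftarrow>vs. xey (x * act a v) (star v))" for x a
  proof -
    have lin: "clinear (\<lambda>z. (x * z) \<otimes>\<^sub>C g)" for g
      by (simp add: clinear_iff distrib_left mult_scaleC_right tensor_add_left tensor_scaleC_left)
    have "(\<Sum>v\<leftarrow>vs. xey (x * act a v) (star v))
      = (\<Sum>g\<in>G. (x * (\<Sum>v\<leftarrow>vs. act a v * act (S (star g)) (star v))) \<otimes>\<^sub>C g)"
      unfolding xey_eq sum_sum_list_swap[symmetric] clinear_sum_list[OF lin]
      by (simp add: mult.assoc)
    also have "\<dots> = (\<Sum>g\<in>G. x \<otimes>\<^sub>C (\<tau> (a * star g) *\<^sub>C g))"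
      by (simp add: sum_act_mult_act_star S_S \<tau>_commute mult_scaleC_right tensor_scaleC_left
          tensor_scaleC_right)
    also have "\<dots> = x \<otimes>\<^sub>C (\<Sum>g\<in>G. \<tau> (a * star g) *\<^sub>C g)"
      by (rule clinear_sum[symmetric]) (simp add: clinear_iff tensor_add_right tensor_scaleC_right)
    finally show ?thesis by (simp only: expansion[symmetric])
  qed
  let ?X = "complex_vector.span {xey x y | x y. True}"
  have sum: "(\<Sum>v\<leftarrow>ws. xey (f v) (h v)) \<in> ?X" for ws :: "'m list" and f h
  proof (induction ws)
    case (Cons w ws)
    have "xey (f w) (h w) \<in> ?X" by (rule complex_vector.span_base) blast
    then show ?case using Cons by (simp add: complex_vector.span_add)
  qed (simp add: complex_vector.span_zero)
  have "t \<in> ?X" for t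
  proof (induction t)
    case (pure x a)
    show ?case unfolding expand[of x a] by (rule sum)
  qed (simp_all add: complex_vector.span_zero complex_vector.span_add)
  then show ?thesis unfolding saturated_iff by blast
qed

end

end

theorem theorem3p3:
  fixes \<Delta> :: "'a::cstar_algebra \<Rightarrow> ('a, 'a) tensor"
    and \<epsilon> :: "'a \<Rightarrow> complex"
    and S :: "'a \<Rightarrow> 'a"
    and act :: "'a \<Rightarrow> 'm::cstar_algebra \<Rightarrow> 'm"
    and e :: 'a
    and E :: "'m \<Rightarrow> 'm"
  assumes "hopf_action \<Delta> \<epsilon> S act"
    and "distinguished_projection \<epsilon> e"
    and "\<And>x. E x = act e x"
  shows "saturated \<Delta> act e \<longleftrightarrow>
    index_finite_type E (fixed_point_algebra \<epsilon> act) \<and>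
    Index E = of_nat (complex_vector.dim (UNIV :: 'a set)) *\<^sub>C 1"
proof -
  interpret hopf_action \<Delta> \<epsilon> S act by (rule assms(1))
  interpret hopf_projection \<Delta> \<epsilon> S e by unfold_locales (rule assms(2))
  obtain G :: "'a set" and \<tau> :: "'a \<Rightarrow> complex" where G:
    "finite G" "clinear \<tau>" "\<And>x y. \<tau> (x * y) = \<tau> (y * x)"
    "\<tau> 1 = of_nat (complex_vector.dim (UNIV :: 'a set))"
    "\<And>g h. g \<in> G \<Longrightarrow> h \<in> G \<Longrightarrow> \<tau> (g * star h) = (if g = h then 1 else 0)"
    "\<And>x. x = (\<Sum>g\<in>G. \<tau> (x * star g) *\<^sub>C g)"
    "\<Delta> e = (\<Sum>g\<in>G. S (star g) \<otimes>\<^sub>C g)"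
    by (rule orthonormal_expansion) (rule that; assumption)
  interpret diagonal_action \<Delta> \<epsilon> S act e G \<tau>
    by unfold_locales (fact G | rule clinear_add[OF G(2)] clinear_scaleC[OF G(2)])+
  have E: "E = act e" using assms(3) by (rule ext)
  show ?thesis
    unfolding E
  proof (intro iffI conjI)
    assume sat: "saturated \<Delta> act e"
    show "index_finite_type (act e) fixed"
      unfolding index_finite_type_def
      using faithful_conditional_expectation_act_e saturated_imp(1)[OF sat] by blast
    show "Index (act e) = of_nat (complex_vector.dim (UNIV :: 'a set)) *\<^sub>C 1"
      by (rule saturated_imp(2)[OF sat])
  next
    assume "index_finite_type (act e) fixed \<and>
      Index (act e) = of_nat (complex_vector.dim (UNIV :: 'a set)) *\<^sub>C 1"
    then obtain vs where vs: "quasi_basis (act e) vs"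
      and ind: "Index (act e) = of_nat (complex_vector.dim (UNIV :: 'a set)) *\<^sub>C 1"
      unfolding index_finite_type_def by blast
    show "saturated \<Delta> act e"
      by (rule saturated_if_index[OF vs]) (use ind Index_eq[OF vs] \<tau>_one in simp)
  qed
qed

end
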